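(* Let $G$ be a finite, simple, undirected, connected graph with chromatic number $\chi(G)=k$. Then there is a $k$-coloring $f$ of $G$ such that every vertex of $G$ lies on a full $f$-rainbow path.
   Context: For a positive integer $k$, $[k]=\{1,\dots,k\}$. A $k$-coloring of $G$ is a function $f:V(G)\to[k]$ with $f(u)\neq f(v)$ for every two adjacent vertices $u,v$. The chromatic number $\chi(G)$ is the minimum $k$ such that $G$ has a $k$-coloring. For a $k$-coloring $f$, an $f$-rainbow path is a path $P$ in $G$ such that $f(u)\neq f(v)$ for every two distinct vertices $u,v$ of $P$; it is full if it has order (number of vertices) $k$, i.e. all $k$ colors appear on $P$. *)

theory Defs
  imports Main
begin

definition simple_graph :: "'a set \<Rightarrow> ('a \<Rightarrow> 'a \<Rightarrow> bool) \<Rightarrow> bool" where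
  "simple_graph V E \<longleftrightarrow> finite V \<and> (\<forall>u v. E u v \<longrightarrow> u \<in> V \<and> v \<in> V)
     \<and> (\<forall>u v. E u v \<longrightarrow> E v u) \<and> (\<forall>v. \<not> E v v)"

definition is_path :: "'a set \<Rightarrow> ('a \<Rightarrow> 'a \<Rightarrow> bool) \<Rightarrow> 'a list \<Rightarrow> bool" where
  "is_path V E P \<longleftrightarrow> P \<noteq> [] \<and> set P \<subseteq> V \<and> distinct P
     \<and> (\<forall>i. Suc i < length P \<longrightarrow> E (P ! i) (P ! Suc i))"

definition connected_graph :: "'a set \<Rightarrow> ('a \<Rightarrow> 'a \<Rightarrow> bool) \<Rightarrow> bool" where
  "connected_graph V E \<longleftrightarrow> V \<noteq> {} \<and>
     (\<forall>u\<in>V. \<forall>v\<in>V. \<exists>P. is_path V E P \<and> hd P = u \<and> last P = v)"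

definition is_coloring :: "'a set \<Rightarrow> ('a \<Rightarrow> 'a \<Rightarrow> bool) \<Rightarrow> nat \<Rightarrow> ('a \<Rightarrow> nat) \<Rightarrow> bool" where
  "is_coloring V E k f \<longleftrightarrow> (\<forall>v\<in>V. f v \<in> {1..k}) \<and> (\<forall>u v. E u v \<longrightarrow> f u \<noteq> f v)"

definition chromatic_number :: "'a set \<Rightarrow> ('a \<Rightarrow> 'a \<Rightarrow> bool) \<Rightarrow> nat" where
  "chromatic_number V E = (LEAST k. \<exists>f. is_coloring V E k f)"

definition rainbow_path :: "'a set \<Rightarrow> ('a \<Rightarrow> 'a \<Rightarrow> bool) \<Rightarrow> ('a \<Rightarrow> nat) \<Rightarrow> 'a list \<Rightarrow> bool" where
  "rainbow_path V E f P \<longleftrightarrow> is_path V E P \<and>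
     (\<forall>i j. i < length P \<longrightarrow> j < length P \<longrightarrow> i \<noteq> j \<longrightarrow> f (P ! i) \<noteq> f (P ! j))"

definition full_rainbow_path :: "'a set \<Rightarrow> ('a \<Rightarrow> 'a \<Rightarrow> bool) \<Rightarrow> nat \<Rightarrow> ('a \<Rightarrow> nat) \<Rightarrow> 'a list \<Rightarrow> bool" where
  "full_rainbow_path V E k f P \<longleftrightarrow> rainbow_path V E f P \<and> length P = k"

end

theory Submission
  imports Defs
begin

text \<open>
  Colours are \<open>0, \<dots>, K\<close> with \<open>k = K + 1\<close>; the case \<open>k \<le> 2\<close> is trivial. The basic move recolours a set \<open>S\<close>
  by adding a constant modulo \<open>m\<close>. Advanced one unit at a time, this stays proper until some \<open>s \<in> S\<close> has colour
  one less (mod \<open>m\<close>) than a neighbour outside \<open>S\<close>, so any family of walks along which the colour grows by one can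
  be extended to a new vertex.

  Take a colouring with as few vertices of colour \<open>K\<close> as possible. However the other vertices are coloured with
  \<open>K\<close> colours, every vertex of colour \<open>K\<close> sees all colours, so rotations modulo \<open>K\<close> are free. They yield a map
  \<open>p\<close> sending each vertex to a neighbour: from colour \<open>K\<close> to \<open>0\<close>, otherwise up by one modulo \<open>K\<close>, until a vertex of
  colour \<open>K - 1\<close> next to colour \<open>K\<close> is met. A cycle of \<open>p\<close> is a sequence of blocks \<open>0, \<dots>, K - 1\<close>, some of them
  preceded by \<open>K\<close>. Recolouring the last vertex of every other unprotected block by \<open>K\<close> puts each vertex of the
  cycle on a full rainbow path; moreover each of them starts a walk that is either full and consecutive modulo
  \<open>K + 1\<close>, or consecutive in the cyclic order that omits one of the colours \<open>K\<close>, \<open>K - 1\<close>.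

  All other vertices are attached to this core by rotations modulo \<open>K + 1\<close> and inherit a walk of one of these
  kinds. A vertex whose walk omits a colour need not lie on a full rainbow path yet. But it lies on the walk of a
  descendant that either starts a full walk or is used by no other walk; in the latter case the descendant sees the
  omitted colour or may be recoloured by it.
\<close>

section \<open>Recolouring a vertex set by a cyclic shift\<close>

text \<open>Shift the colours of \<open>S\<close> by the least \<open>j\<close> for which some
  \<open>s\<close> in \<open>S\<close> gets colour \<open>att u\<close> for a neighbour
  \<open>u\<close> outside \<open>S\<close>; shifting \<open>s0\<close> far enough shows that such a
  \<open>j\<close> exists. A clash of \<open>s\<close> with \<open>u\<close> at \<open>j\<close>
  would give \<open>s\<close> the colour \<open>att u\<close>, one below \<open>f u\<close>, a shift
  earlier or, for \<open>j = 0\<close>, contradict properness of \<open>f\<close>. If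
  \<open>f u\<close> is at least \<open>m\<close>, no clash is possible and \<open>att u\<close> can
  be chosen freely below \<open>m\<close>.\<close>

lemma colour_rotation:
  fixes f att :: "'a \<Rightarrow> nat" and E :: "'a \<Rightarrow> 'a \<Rightarrow> bool"
  assumes sym: "\<And>u v. E u v \<Longrightarrow> E v u"
    and proper: "\<And>u v. E u v \<Longrightarrow> f u \<noteq> f v"
    and small: "\<And>s. s \<in> S \<Longrightarrow> f s < m"
    and edge: "E s0 u0" "s0 \<in> S" "u0 \<notin> S"
    and att: "\<And>u. att u < m" "\<And>u. u \<notin> S \<Longrightarrow> f u < m \<Longrightarrow> att u = (f u + (m - 1)) mod m"
  shows "\<exists>g. (\<forall>v. v \<notin> S \<longrightarrow> g v = f v) \<and> (\<forall>v\<in>S. g v < m) \<and> (\<forall>u v. E u v \<longrightarrow> g u \<noteq> g v) \<and>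
    (\<exists>s u. s \<in> S \<and> u \<notin> S \<and> E s u \<and> g s = att u)"
proof -
  define hit where "hit j \<longleftrightarrow> (\<exists>s u. s \<in> S \<and> u \<notin> S \<and> E s u \<and> (f s + j) mod m = att u)" for j
  have "(f s0 + (m - f s0 + att u0)) mod m = att u0"
    using small[OF edge(2)] att(1)[of u0] by simp
  then have "hit (m - f s0 + att u0)"
    using edge unfolding hit_def by blast
  then have hit: "hit (Least hit)" and least: "\<And>i. i < Least hit \<Longrightarrow> \<not> hit i"
    by (auto intro: LeastI dest: not_less_Least)
  define j where "j = Least hit"
  define g where "g v = (if v \<in> S then (f v + j) mod m else f v)" for v
  have "m > 0" using small[OF edge(2)] by simp
  have inner: "g u \<noteq> g v" if "E u v" "u \<in> S" "v \<in> S" for u v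
  proof -
    have "f u mod m \<noteq> f v mod m" using proper that small by simp
    then show ?thesis using that by (simp add: g_def nat_mod_eq_iff)
  qed
  have outer: "g s \<noteq> g u" if "E s u" "s \<in> S" "u \<notin> S" for s u
  proof
    assume eq: "g s = g u"
    then have gu: "f u = (f s + j) mod m" using that by (auto simp: g_def)
    then have "f u < m" using \<open>m > 0\<close> by simp
    show False
    proof (cases j)
      case 0
      then show False using gu small[OF that(2)] proper[OF that(1)] by simp
    next
      case (Suc i)
      have "att u = ((f s + Suc i) mod m + (m - 1)) mod m" using att(2) that gu \<open>f u < m\<close> Suc by simp
      also have "\<dots> = (f s + Suc i + (m - 1)) mod m" by (simp only: mod_add_left_eq)
      also have "f s + Suc i + (m - 1) = f s + i + m" using \<open>m > 0\<close> by simp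
      finally have "(f s + i) mod m = att u" by simp
      then have "hit i" using that unfolding hit_def by blast
      then show False using least[of i] Suc j_def by simp
    qed
  qed
  have "g u \<noteq> g v" if "E u v" for u v
    using that inner outer[of u v] outer[of v u] sym proper by (cases "u \<in> S"; cases "v \<in> S") (auto simp: g_def)
  moreover have "\<exists>s u. s \<in> S \<and> u \<notin> S \<and> E s u \<and> g s = att u"
    using hit unfolding hit_def g_def j_def by auto
  ultimately show ?thesis using \<open>m > 0\<close> by (intro exI[of _ g]) (auto simp: g_def)
qed

section \<open>Minimal top colour class and the pointer map\<close>

text \<open>Here \<open>K + 1\<close> is the chromatic number, and colours start at \<open>0\<close>.\<close>

locale chromatic_graph =
  fixes V :: "'a set" and E :: "'a \<Rightarrow> 'a \<Rightarrow> bool" and K :: nat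
  assumes finite_V: "finite V"
    and E_V: "E u v \<Longrightarrow> u \<in> V \<and> v \<in> V"
    and E_sym: "E u v \<Longrightarrow> E v u"
    and E_irrefl: "\<not> E v v"
    and cut: "S \<subseteq> V \<Longrightarrow> S \<noteq> {} \<Longrightarrow> S \<noteq> V \<Longrightarrow> \<exists>s u. s \<in> S \<and> u \<in> V - S \<and> E s u"
    and K2: "2 \<le> K"
    and not_K_colourable: "\<not> (\<exists>f::'a \<Rightarrow> nat. (\<forall>v\<in>V. f v < K) \<and> (\<forall>u v. E u v \<longrightarrow> f u \<noteq> f v))"
    and Suc_K_colourable: "\<exists>f::'a \<Rightarrow> nat. (\<forall>v\<in>V. f v \<le> K) \<and> (\<forall>u v. E u v \<longrightarrow> f u \<noteq> f v)"
begin

definition proper :: "('a \<Rightarrow> nat) \<Rightarrow> bool" where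
  "proper f \<longleftrightarrow> (\<forall>v\<in>V. f v \<le> K) \<and> (\<forall>u v. E u v \<longrightarrow> f u \<noteq> f v)"

definition rooted_at_top :: "('a \<Rightarrow> nat) \<Rightarrow> 'a \<Rightarrow> bool" where
  "rooted_at_top f v \<longleftrightarrow> f v = K - 1 \<and> (\<exists>w. E v w \<and> f w = K)"

text \<open>The steps are counted because the least count later serves as the measure that decreases
  along the pointer map.\<close>

inductive reaches :: "('a \<Rightarrow> nat) \<Rightarrow> nat \<Rightarrow> 'a \<Rightarrow> bool" for f where
  root: "v \<in> V \<Longrightarrow> rooted_at_top f v \<Longrightarrow> reaches f 0 v"
| step: "reaches f n u \<Longrightarrow> E v u \<Longrightarrow> f v < K \<Longrightarrow> f u = Suc (f v) mod K \<Longrightarrow> reaches f (Suc n) v"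

lemma reaches_V: "reaches f n v \<Longrightarrow> v \<in> V \<and> f v < K"
  by (induction rule: reaches.induct) (use E_V K2 in \<open>auto simp: rooted_at_top_def\<close>)

text \<open>Two nested extremal choices: the number of vertices of colour \<open>K\<close> is
  minimal, and then the number of vertices on chains of \<open>reaches\<close> is maximal. By the
  first, a vertex of colour \<open>K\<close> sees every \<open>c < K\<close>, since otherwise it
  could take colour \<open>c\<close>. By the second, no vertex below \<open>K\<close> is off the
  chains: rotating the set \<open>S\<close> of such vertices modulo \<open>K\<close> would attach
  one of them and break no chain.\<close>

lemma ex_rooted_colouring:
  obtains f where "proper f" 
    "\<And>w c. w \<in> V \<Longrightarrow> f w = K \<Longrightarrow> c < K \<Longrightarrow> \<exists>y. E w y \<and> f y = c"
    "\<And>v. v \<in> V \<Longrightarrow> f v < K \<Longrightarrow> \<exists>n. reaches f n v"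
proof -
  define top where "top f = {v\<in>V. f v = K}" for f :: "'a \<Rightarrow> nat"
  define R where "R f = {v. \<exists>n. reaches f n v}" for f
  obtain f0 where f0: "proper f0" using Suc_K_colourable unfolding proper_def by blast
  define f1 where "f1 = arg_min (\<lambda>f. card (top f)) proper"
  have f1: "proper f1" and min: "\<And>h. proper h \<Longrightarrow> card (top f1) \<le> card (top h)"
    using arg_min_natI[of proper f0] arg_min_nat_le[of proper _ "\<lambda>f. card (top f)"] f0 unfolding f1_def by blast+
  define Q where "Q f \<longleftrightarrow> proper f \<and> card (top f) = card (top f1)" for f
  have finR: "finite (R f)" "card (R f) \<le> card V" for f
    using reaches_V finite_V by (auto simp: R_def intro!: card_mono intro: finite_subset[of _ V])
  have "\<exists>f. Q f \<and> (\<forall>h. Q h \<longrightarrow> card (R h) \<le> card (R f))"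
    using ex_has_greatest_nat[of Q f1 "\<lambda>f. card (R f)" "Suc (card V)"] f1 finR
    unfolding Q_def by (auto simp: less_Suc_eq_le)
  then obtain f where f: "Q f" and max: "\<And>h. Q h \<Longrightarrow> card (R h) \<le> card (R f)" by blast
  have pf: "proper f" using f Q_def by simp
  have sees: "\<exists>y. E w y \<and> f y = c" if w: "w \<in> V" "f w = K" "c < K" for w c
  proof (rule ccontr)
    assume no: "\<not> ?thesis"
    define h where "h = f(w := c)"
    have "proper h" using pf no w E_sym E_irrefl unfolding proper_def h_def
      by (auto split: if_splits)
    moreover have "top h = top f - {w}" using w by (auto simp: top_def h_def)
    moreover have "w \<in> top f" "finite (top f)" using w finite_V by (auto simp: top_def)
    ultimately have "card (top h) < card (top f)" using card_Diff1_less by metis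
    then show False using min[OF \<open>proper h\<close>] f Q_def by simp
  qed
  have "R f \<union> top f = V"
  proof (rule ccontr)
    assume ne: "R f \<union> top f \<noteq> V"
    define S where "S = V - (R f \<union> top f)"
    have "S \<noteq> {}" using ne reaches_V unfolding S_def R_def top_def by auto
    moreover have "S \<noteq> V"
    proof
      assume "S = V"
      then have "\<forall>v\<in>V. f v < K" using pf unfolding S_def top_def proper_def by force
      then show False using not_K_colourable pf unfolding proper_def by blast
    qed
    ultimately obtain s0 u0 where "s0 \<in> S" "u0 \<in> V - S" "E s0 u0" using cut[of S] S_def by auto
    moreover have small: "f s < K" if "s \<in> S" for s
      using that pf unfolding S_def top_def proper_def by force
    \<comment> \<open>\<open>att u\<close> is the colour with which a neighbour \<open>s\<close>
      extends the chain of \<open>u\<close>; for \<open>u\<close> of colour \<open>K\<close> it is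
      \<open>K - 1\<close>, which makes \<open>s\<close> a root.\<close>
    moreover define att where "att u = (if f u < K then (f u + (K - 1)) mod K else K - 1)" for u
    moreover have att_small: "att u < K" for u using K2 by (simp add: att_def)
    ultimately have "\<exists>g. (\<forall>v. v \<notin> S \<longrightarrow> g v = f v) \<and> (\<forall>v\<in>S. g v < K) \<and> (\<forall>u v. E u v \<longrightarrow> g u \<noteq> g v) \<and>
      (\<exists>s u. s \<in> S \<and> u \<notin> S \<and> E s u \<and> g s = att u)"
      using pf E_sym by (intro colour_rotation[of E f S K s0 u0 att]) (auto simp: proper_def)
    then obtain g s u where g: "\<And>v. v \<notin> S \<Longrightarrow> g v = f v" "\<And>v. v \<in> S \<Longrightarrow> g v < K"
      "\<And>u v. E u v \<Longrightarrow> g u \<noteq> g v"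
      and "s \<in> S" "u \<notin> S" "E s u" "g s = att u"
      by blast
    then have su: "s \<in> S" "u \<notin> S" "E s u" "g s = (if f u < K then (f u + (K - 1)) mod K else K - 1)"
      by (simp_all add: att_def)
    have "proper g" using g pf small unfolding proper_def by (metis less_imp_le)
    have top: "top g = top f" using g by (force simp: top_def S_def)
    \<comment> \<open>Neither the chains nor the vertices of colour \<open>K\<close> meet
      \<open>S\<close>, so every chain survives.\<close>
    have keep: "reaches g n v" if "reaches f n v" for n v
      using that
    proof (induction rule: reaches.induct)
      case (root v)
      then have "v \<notin> S" using reaches.root by (auto simp: S_def R_def)
      moreover obtain w where w: "E v w" "f w = K" using root rooted_at_top_def by auto
      moreover have "w \<notin> S" using w E_V by (auto simp: S_def top_def)
      ultimately show ?case using root g(1) by (intro reaches.root) (auto simp: rooted_at_top_def)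
    next
      case (step n u v)
      have "reaches f (Suc n) v" using step by (intro reaches.step)
      then have "v \<notin> S" "u \<notin> S" using step by (auto simp: S_def R_def)
      then show ?case using step g(1) by (intro reaches.step[of g n u v]) auto
    qed
    have "s \<in> R g"
    proof (cases "f u < K")
      case True
      have "u \<in> V" using su E_V by blast
      then have "u \<in> R f" using True su by (auto simp: S_def top_def)
      then obtain n where "reaches g n u" using keep unfolding R_def by blast
      moreover have "g u = Suc (g s) mod K"
      proof -
        have "Suc (g s) mod K = (f u + (K - 1) + 1) mod K" using su True by (simp add: mod_Suc_eq)
        also have "\<dots> = f u" using True K2 by simp
        finally show ?thesis using g su by simp
      qed
      ultimately have "reaches g (Suc n) s" using su(3) g(2)[OF su(1)] by (intro reaches.step[of g n u s])
      then show ?thesis unfolding R_def by blast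
    next
      case False
      then have "f u = K" using pf su E_V unfolding proper_def by (meson le_neq_implies_less)
      then have "rooted_at_top g s" using su g(1) by (auto simp: rooted_at_top_def)
      then show ?thesis using reaches.root su E_V unfolding R_def by blast
    qed
    moreover have "R f \<subseteq> R g" using keep unfolding R_def by blast
    moreover have "s \<notin> R f" using su S_def by blast
    ultimately have "card (R f) < card (R g)" using finR by (metis psubsetI psubset_card_mono)
    moreover have "Q g" using \<open>proper g\<close> top f Q_def by simp
    ultimately show False using max by fastforce
  qed
  then have "\<exists>n. reaches f n v" if "v \<in> V" "f v < K" for v
    using that unfolding R_def top_def by blast
  then show ?thesis using that pf sees by blast
qed

text \<open>A vertex below \<open>K\<close> that is not a root points to one with a strictly shorter
  chain, so iteration arrives at colour \<open>K\<close>. From there a pointer to colour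
  \<open>0\<close> exists because these vertices see all colours.\<close>

lemma ex_pointer_map:
  "\<exists>f p. proper f \<and> (\<forall>v\<in>V. E v (p v) \<and> (f v = K \<longrightarrow> f (p v) = 0) \<and>
    (rooted_at_top f v \<longrightarrow> f (p v) = K) \<and>
    (f v < K \<longrightarrow> \<not> rooted_at_top f v \<longrightarrow> f (p v) = Suc (f v) mod K) \<and> (\<exists>n. f ((p ^^ n) v) = K))"
proof -
  obtain f where f: "proper f"
    "\<And>w c. w \<in> V \<Longrightarrow> f w = K \<Longrightarrow> c < K \<Longrightarrow> \<exists>y. E w y \<and> f y = c"
    "\<And>v. v \<in> V \<Longrightarrow> f v < K \<Longrightarrow> \<exists>n. reaches f n v"
    using ex_rooted_colouring by metis
  define d where "d v = (LEAST n. reaches f n v)" for v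
  have d: "reaches f (d v) v" if "v \<in> V" "f v < K" for v
    using f(3)[OF that] unfolding d_def by (metis LeastI)
  have d_le: "d v \<le> n" if "reaches f n v" for n v
    using that unfolding d_def by (rule Least_le)
  define P where "P v y \<longleftrightarrow> E v y \<and> (if f v = K then f y = 0 else if rooted_at_top f v then f y = K
     else f y = Suc (f v) mod K \<and> d y < d v)" for v y
  have "\<exists>y. P v y" if v: "v \<in> V" for v
  proof (cases "f v < K")
    case False
    then have "f v = K" using f(1) v unfolding proper_def by (meson le_neq_implies_less)
    then show ?thesis using f(2)[OF v] K2 unfolding P_def by force
  next
    case True
    show ?thesis using d[OF v True]
    proof cases
      case root
      then show ?thesis using True unfolding P_def rooted_at_top_def by auto
    next
      case (step n u)
      then have "d u < d v" using d_le[of n u] by simp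
      then show ?thesis using step True unfolding P_def
        by (cases "rooted_at_top f v") (auto simp: rooted_at_top_def)
    qed
  qed
  then obtain p where p: "\<And>v. v \<in> V \<Longrightarrow> P v (p v)" by metis
  have "\<exists>n. f ((p ^^ n) v) = K" if "v \<in> V" for v
    using that
  proof (induction "d v" arbitrary: v rule: less_induct)
    case less
    note Pv = p[OF less.prems, unfolded P_def]
    have "p v \<in> V" using Pv E_V by blast
    show ?case
    proof (cases "f v = K \<or> rooted_at_top f v")
      case True
      then show ?thesis
      proof
        assume "f v = K"
        then show ?thesis by (intro exI[of _ 0]) simp
      next
        assume "rooted_at_top f v"
        then show ?thesis using Pv K2 by (intro exI[of _ 1]) (auto simp: rooted_at_top_def split: if_splits)
      qed
    next
      case False
      then obtain n where "f ((p ^^ n) (p v)) = K" using less.hyps[of "p v"] Pv \<open>p v \<in> V\<close> by auto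
      then show ?thesis by (intro exI[of _ "Suc n"]) (simp add: funpow_swap1)
    qed
  qed
  then show ?thesis using f(1) p K2
    by (intro exI[of _ f] exI[of _ p]) (auto simp: P_def rooted_at_top_def split: if_splits)
qed

section \<open>Colour sequences along a cycle\<close>

text \<open>
  \<open>F i\<close> is the colour of the \<open>i\<close>-th vertex on the cycle, and \<open>T i\<close> says that its successor has colour \<open>K\<close>. The last
  vertex of a block is recoloured iff neither \<open>T\<close> holds there nor the block is preceded by a vertex that has or
  receives colour \<open>K\<close>.
\<close>

fun closes_block :: "(nat \<Rightarrow> nat) \<Rightarrow> (nat \<Rightarrow> bool) \<Rightarrow> nat \<Rightarrow> bool" where
  "closes_block F T i = (if 0 < K \<and> K \<le> i
     then F i = K - 1 \<and> \<not> T i \<and> F (i - K) \<noteq> K \<and> \<not> closes_block F T (i - K) else False)"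

declare closes_block.simps [simp del]

lemma closes_block_iff:
  "closes_block F T i \<longleftrightarrow> K \<le> i \<and> F i = K - 1 \<and> \<not> T i \<and> F (i - K) \<noteq> K \<and> \<not> closes_block F T (i - K)"
  using K2 by (subst closes_block.simps) auto

text \<open>
  The colour sequence of a walk is \<^emph>\<open>narrow\<close> of type \<open>t\<close> if it omits the colour \<open>K - t\<close> (which \<open>rot t\<close> sends to \<open>K\<close>)
  and is consecutive modulo \<open>K\<close> after applying \<open>rot t\<close>. Only \<open>t = 0\<close> and \<open>t = 1\<close> occur.
\<close>

definition rot :: "nat \<Rightarrow> nat \<Rightarrow> nat" where
  "rot a c = (c + a) mod Suc K"

definition wide :: "(nat \<Rightarrow> nat) \<Rightarrow> bool" where
  "wide c \<longleftrightarrow> (\<forall>j\<le>K. c j = (c 0 + j) mod Suc K)"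

definition narrow :: "nat \<Rightarrow> (nat \<Rightarrow> nat) \<Rightarrow> bool" where
  "narrow a c \<longleftrightarrow> (\<forall>j<K. rot a (c j) = (rot a (c 0) + j) mod K)"

lemma wide_inj:
  assumes "wide c"
  shows "inj_on c {..K}"
proof (rule inj_onI)
  fix i j assume ij: "i \<in> {..K}" "j \<in> {..K}" "c i = c j"
  then have "(c 0 + i) mod Suc K = (c 0 + j) mod Suc K" using assms unfolding wide_def by (metis atMost_iff)
  then obtain q r where "c 0 + i + Suc K * q = c 0 + j + Suc K * r" using nat_mod_eq_iff by blast
  then have "i + Suc K * q = j + Suc K * r" by linarith
  then have "i mod Suc K = j mod Suc K" by (metis mod_mult_self2)
  then show "i = j" using ij by simp
qed

text \<open>Let \<open>e\<close> be the end of the block of \<open>i\<close> and \<open>m\<close>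
  the position before that block. If \<open>T e\<close>, the sequence from \<open>i\<close> runs
  through \<open>K\<close> and is wide. If \<open>e\<close> is recoloured, the colours from
  \<open>m\<close> to \<open>e\<close> are \<open>K - 1, 0, ..., K - 2, K\<close>, and the sequence
  from \<open>i\<close> omits \<open>K - 1\<close>. Otherwise \<open>G m = K\<close>, so the colours
  from \<open>m\<close> to \<open>e\<close> are \<open>K, 0, ..., K - 1\<close>, and the sequence
  from \<open>i\<close> omits \<open>K\<close>.\<close>

lemma block_recolouring:
  fixes F G :: "nat \<Rightarrow> nat" and T :: "nat \<Rightarrow> bool"
  assumes F_le: "\<And>i. F i \<le> K"
    and F_top: "\<And>i. F i = K \<Longrightarrow> F (Suc i) = 0"
    and F_T: "\<And>i. T i \<Longrightarrow> F i = K - 1 \<and> F (Suc i) = K"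
    and F_Suc: "\<And>i. F i < K \<Longrightarrow> \<not> T i \<Longrightarrow> F (Suc i) = Suc (F i) mod K"
    and G: "\<And>i. G i = (if closes_block F T i then K else F i)"
    and i: "K \<le> i"
  shows "wide (\<lambda>j. G (i + j)) \<or> narrow 0 (\<lambda>j. G (i + j)) \<or> narrow 1 (\<lambda>j. G (i + j))"
    and "\<exists>m j. i = m + j \<and> j \<le> K \<and> inj_on (\<lambda>j. G (m + j)) {..K}"
proof -
  have forward: "F (i + j) = F i + j" if "F i + j < K" for i j
    using that
  proof (induction j)
    case (Suc j)
    then have "F (i + j) = F i + j" by simp
    moreover from this have "\<not> T (i + j)" using F_T[of "i + j"] Suc.prems by auto
    ultimately show ?case using F_Suc[of "i + j"] Suc.prems by simp
  qed simp
  have pred: "F i = c" if "F (Suc i) = Suc c" "Suc c < K" for i c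
  proof -
    have "F i < K" using that F_le[of i] F_top[of i] by (cases "F i = K") simp_all
    moreover have "\<not> T i" using that F_T[of i] by auto
    ultimately have "Suc (F i) mod K = Suc c" "Suc (F i) \<le> K" using F_Suc[of i] that by simp_all
    then show ?thesis by (cases "Suc (F i) = K") simp_all
  qed
  have backward: "F (i - j) = F i - j" if "F i < K" "j \<le> F i" "j \<le> i" for i j
    using that
  proof (induction j)
    case (Suc j)
    then have "F (Suc (i - Suc j)) = Suc (F i - Suc j)" by (simp add: Suc_diff_Suc)
    then show ?case using pred[of "i - Suc j" "F i - Suc j"] Suc.prems by simp
  qed simp
  have plain: "G i = F i" if "F i \<noteq> K - 1" for i
    using that G[of i] closes_block_iff[of F T i] by simp
  \<comment> \<open>A block that follows colour \<open>K\<close> in \<open>G\<close> is never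
    recoloured, by the last two conjuncts of \<open>closes_block_iff\<close>.\<close>
  have from_top: "G (i + Suc j) = j" if "G i = K" "j < K" for i j
  proof -
    have nz: "\<not> closes_block F T (i + K)"
      using that(1) G[of i] by (subst closes_block_iff) (auto split: if_splits)
    have "F (Suc i) = 0"
      using that(1) G[of i] F_top[of i] F_Suc[of i] K2 closes_block_iff[of F T i] by (auto split: if_splits)
    then have F: "F (i + Suc j) = j" using forward[of "Suc i" j] that(2) by simp
    show ?thesis
    proof (cases "Suc j = K")
      case True
      then show ?thesis using F nz G[of "i + Suc j"] by simp
    next
      case False
      then have "j \<noteq> K - 1" using K2 by auto
      then show ?thesis using F plain[of "i + Suc j"] by simp
    qed
  qed
  have wide_top: "wide (\<lambda>j. G (i + j))" if "G i = K" for i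
    unfolding wide_def
  proof (intro allI impI)
    fix j assume "j \<le> K"
    then show "G (i + j) = (G (i + 0) + j) mod Suc K"
      using from_top[OF that] that by (cases j) (simp_all add: mod_if)
  qed
  define c where "c = F i"
  define e where "e = i + (K - 1 - c)"
  \<comment> \<open>Since \<open>i\<close> is at least \<open>K\<close>, so is \<open>e\<close>, and
    this subtraction is not truncated.\<close>
  define m where "m = e - K"
  have "(wide (\<lambda>j. G (i + j)) \<or> narrow 0 (\<lambda>j. G (i + j)) \<or> narrow 1 (\<lambda>j. G (i + j))) \<and>
    (\<exists>m j. i = m + j \<and> j \<le> K \<and> inj_on (\<lambda>j. G (m + j)) {..K})"
  proof (cases "G i = K")
    case True
    then show ?thesis using wide_top[OF True] wide_inj by (intro conjI exI[of _ i] exI[of _ 0]) auto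
  next
    case False
    then have c: "c < K" using F_le[of i] G[of i] unfolding c_def by (auto split: if_splits)
    have Gi: "G i = c" using False G[of i] unfolding c_def by (auto split: if_splits)
    have run: "F (i + j) = c + j" if "c + j < K" for j using forward that c_def by simp
    have run': "G (i + j) = c + j" if "c + j < K - 1" for j using run[of j] plain[of "i + j"] that by simp
    have Fe: "F e = K - 1" using run[of "K - 1 - c"] c unfolding e_def by simp
    have e: "K \<le> e" "i \<le> e" "e - i = K - 1 - c" using i e_def by simp_all
    have im: "i = m + Suc c" using e c unfolding m_def by simp
    have em: "e = m + K" using e m_def by simp
    have T_case: ?thesis if "T e"
    proof -
      have "\<not> closes_block F T e" using that closes_block_iff[of F T e] by simp
      then have Ge: "G e = K - 1" using Fe G by simp
      have "F (Suc e) = K" using F_T that by simp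
      then have top: "G (Suc e) = K" using plain[of "Suc e"] K2 by simp
      have "wide (\<lambda>j. G (i + j))"
        unfolding wide_def
      proof (intro allI impI)
        fix j assume "j \<le> K"
        consider "c + j < K - 1" | "c + j = K - 1" | "c + j = K" | l where "c + j = K + Suc l"
          using less_imp_Suc_add[of K "c + j"] by fastforce
        then show "G (i + j) = (G (i + 0) + j) mod Suc K"
        proof cases
          case 1
          then show ?thesis using run'[of j] Gi by simp
        next
          case 2
          then have "i + j = e" using e_def by simp
          then show ?thesis using Ge Gi 2 by simp
        next
          case 3
          then have "i + j = Suc e" using e_def K2 c by simp
          then show ?thesis using top Gi 3 by simp
        next
          case 4
          then have "i + j = Suc e + Suc l" and "l < K" using e_def K2 c \<open>j \<le> K\<close> by simp_all
          then have "G (i + j) = l" using from_top[OF top, of l] by simp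
          moreover have "c + j = Suc K + l" using 4 by simp
          ultimately show ?thesis using Gi \<open>l < K\<close> by (metis add_0_right less_SucI mod_add_self1 mod_less)
        qed
      qed
      then show ?thesis using wide_inj by (intro conjI exI[of _ i] exI[of _ 0]) auto
    qed
    have Z_case: ?thesis if "G e = K"
    proof -
      have Z: "closes_block F T e" using that G[of e] Fe K2 by (auto split: if_splits)
      then have m: "F m \<noteq> K" "\<not> closes_block F T m" using closes_block_iff[of F T e] m_def by auto
      have "c \<noteq> K - 1" using that False e_def by auto
      then have c': "c < K - 1" using c by simp
      have "i - c = Suc m" "c \<le> i" using im by simp_all
      then have "F (Suc m) = 0" using backward[of i c] c c_def[symmetric] by simp
      moreover have "\<not> T m" using F_T[of m] \<open>F (Suc m) = 0\<close> K2 by auto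
      ultimately have "Suc (F m) mod K = 0" "Suc (F m) \<le> K" using m(1) F_le[of m] F_Suc[of m] by auto
      then have "F m = K - 1" by (cases "Suc (F m) = K") auto
      then have Gm: "G m = K - 1" using m G[of m] by simp
      have Gj: "G (m + Suc j) = j" if "Suc j < K" for j
      proof -
        have "F (m + Suc j) = j" using forward[of "Suc m" j] \<open>F (Suc m) = 0\<close> that by simp
        then show ?thesis using plain[of "m + Suc j"] that by simp
      qed
      have vals: "G (m + j) = (if j = 0 then K - 1 else if j = K then K else j - 1)" if "j \<le> K" for j
      proof (cases j)
        case 0
        then show ?thesis using Gm by simp
      next
        case (Suc l)
        then show ?thesis using Gj[of l] \<open>G e = K\<close> em that by (cases "j = K") auto
      qed
      have "inj_on (\<lambda>j. G (m + j)) {..K}"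
      proof (rule inj_onI)
        fix a b assume "a \<in> {..K}" "b \<in> {..K}" "G (m + a) = G (m + b)"
        then show "a = b" using vals[of a] vals[of b] by (auto split: if_splits)
      qed
      moreover have "narrow 1 (\<lambda>j. G (i + j))"
        unfolding narrow_def
      proof (intro allI impI)
        fix j assume j: "j < K"
        consider "c + j < K - 1" | "c + j = K - 1" | l where "c + j = K + l"
          using le_Suc_ex[of K "c + j"] by fastforce
        then show "rot 1 (G (i + j)) = (rot 1 (G (i + 0)) + j) mod K"
        proof cases
          case 1
          then show ?thesis using run'[of j] Gi by (simp add: rot_def)
        next
          case 2
          then have "i + j = e" using e_def by simp
          moreover have "Suc c + j = K" using 2 K2 by simp
          ultimately show ?thesis using that Gi c by (simp add: rot_def)
        next
          case 3
          then have "i + j = e + Suc l" and "l < K" using e_def K2 c j by simp_all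
          then have "G (i + j) = l" using from_top[OF that, of l] by simp
          moreover have "Suc c + j = K + Suc l" and l: "Suc l < K" using 3 c' j by simp_all
          then have "(Suc c + j) mod K = Suc l" by (metis mod_add_self1 mod_less)
          ultimately show ?thesis using Gi c l by (simp add: rot_def)
        qed
      qed
      ultimately show ?thesis using im c by (intro conjI exI[of _ m] exI[of _ "Suc c"]) auto
    qed
    have O_case: ?thesis if "\<not> T e" "G e \<noteq> K"
    proof -
      have nZ: "\<not> closes_block F T e" using that G[of e] by auto
      then have Ge: "G e = K - 1" using G Fe by simp
      have "G m = K" using nZ closes_block_iff[of F T e] that e Fe G[of m] m_def by auto
      then have "inj_on (\<lambda>j. G (m + j)) {..K}" using wide_top wide_inj by blast
      moreover have "narrow 0 (\<lambda>j. G (i + j))"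
        unfolding narrow_def
      proof (intro allI impI)
        fix j assume j: "j < K"
        have "F (Suc e) = 0" using F_Suc[of e] that Fe K2 by simp
        consider "c + j < K - 1" | "c + j = K - 1" | l where "c + j = K + l"
          using le_Suc_ex[of K "c + j"] by fastforce
        then show "rot 0 (G (i + j)) = (rot 0 (G (i + 0)) + j) mod K"
        proof cases
          case 1
          then show ?thesis using run'[of j] Gi by (simp add: rot_def)
        next
          case 2
          then have "i + j = e" using e_def by simp
          then show ?thesis using Ge Gi 2 c by (simp add: rot_def)
        next
          case 3
          then have "i + j = Suc e + l" and l: "Suc l < K" using e_def K2 c j by simp_all
          then have "F (i + j) = l" using forward[of "Suc e" l] \<open>F (Suc e) = 0\<close> by simp
          then have "G (i + j) = l" using plain l by simp
          then show ?thesis using Gi c 3 l by (simp add: rot_def)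
        qed
      qed
      ultimately show ?thesis using im c by (intro conjI exI[of _ m] exI[of _ "Suc c"]) auto
    qed
    show ?thesis using T_case Z_case O_case by blast
  qed
  then show "wide (\<lambda>j. G (i + j)) \<or> narrow 0 (\<lambda>j. G (i + j)) \<or> narrow 1 (\<lambda>j. G (i + j))"
    and "\<exists>m j. i = m + j \<and> j \<le> K \<and> inj_on (\<lambda>j. G (m + j)) {..K}" by blast+
qed


section \<open>The core: a cycle of the pointer map\<close>

text \<open>
  Walks are infinite sequences of which only the first \<open>K + 1\<close> (type \<open>2\<close>) or the first \<open>K\<close> (types \<open>0\<close> and \<open>1\<close>)
  entries matter, so prepending a vertex drops the last relevant one automatically.
\<close>

definition walk :: "('a \<Rightarrow> nat) \<Rightarrow> nat \<Rightarrow> (nat \<Rightarrow> 'a) \<Rightarrow> bool" where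
  "walk g t w \<longleftrightarrow> (if t = 2 then (\<forall>i<K. E (w i) (w (Suc i))) \<and> wide (\<lambda>i. g (w i))
     else t < 2 \<and> (\<forall>i. Suc i < K \<longrightarrow> E (w i) (w (Suc i))) \<and> narrow t (\<lambda>i. g (w i)))"

definition full :: "('a \<Rightarrow> nat) \<Rightarrow> (nat \<Rightarrow> 'a) \<Rightarrow> bool" where
  "full g P \<longleftrightarrow> (\<forall>i<K. E (P i) (P (Suc i))) \<and> inj_on (\<lambda>i. g (P i)) {..K}"

text \<open>An orbit in a finite set contains a periodic point \<open>y\<close>; moving along the
  orbit of \<open>y\<close> to a point with \<open>Q\<close> keeps the period.\<close>

lemma ex_periodic_point:
  assumes V: "\<And>v. v \<in> V \<Longrightarrow> p v \<in> V" and hit: "\<And>v. v \<in> V \<Longrightarrow> \<exists>n::nat. Q ((p ^^ n) v)"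
  obtains w N where "w \<in> V" "Q w" "0 < N" "(p ^^ N) w = w"
proof -
  have "V \<noteq> {}"
  proof
    assume "V = {}"
    then have "\<And>u v. \<not> E u v" using E_V by blast
    then show False using not_K_colourable \<open>V = {}\<close> by blast
  qed
  then obtain v where v: "v \<in> V" by blast
  have V': "(p ^^ n) u \<in> V" if "u \<in> V" for u n
    using that V by (induction n) auto
  have "finite (range (\<lambda>n. (p ^^ n) v))" using V'[OF v] finite_V by (auto intro: finite_subset)
  then have "\<not> inj (\<lambda>n. (p ^^ n) v)" using infinite_UNIV_nat finite_imageD by blast
  then obtain i j where "i < j" "(p ^^ i) v = (p ^^ j) v"
    unfolding inj_def by (metis linorder_neqE_nat)
  moreover define y where "y = (p ^^ i) v"
  moreover have "(p ^^ (j - i)) ((p ^^ i) v) = (p ^^ j) v"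
    using \<open>i < j\<close> by (metis comp_apply funpow_add le_add_diff_inverse2 less_imp_le)
  ultimately have y: "(p ^^ (j - i)) y = y" "y \<in> V" "0 < j - i"
    using V'[OF v] by auto
  then obtain n where n: "Q ((p ^^ n) y)" using hit by blast
  have "(p ^^ (j - i)) ((p ^^ n) y) = (p ^^ n) ((p ^^ (j - i)) y)"
    by (metis add.commute comp_apply funpow_add)
  then show ?thesis using that[of "(p ^^ n) y" "j - i"] n y V' by simp
qed

text \<open>The core is a cycle of the pointer map through a vertex \<open>w\<close> of colour
  \<open>K\<close>, unrolled to a periodic sequence \<open>x\<close> so that
  \<open>block_recolouring\<close> applies. The recolouring rule is stated for positions and must be
  shown periodic before it determines a colour for each vertex.\<close>

lemma ex_core:
  obtains g X W ty where "proper g" "X \<noteq> {}" "X \<subseteq> V"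
    "\<And>x. x \<in> X \<Longrightarrow> W x 0 = x \<and> range (W x) \<subseteq> X \<and> walk g (ty x) (W x)"
    "\<And>x. x \<in> X \<Longrightarrow> \<exists>P. full g P \<and> range P \<subseteq> X \<and> x \<in> P ` {..K}"
proof -
  obtain f p where f: "proper f" and P: "\<forall>v\<in>V. E v (p v) \<and> (f v = K \<longrightarrow> f (p v) = 0) \<and>
    (rooted_at_top f v \<longrightarrow> f (p v) = K) \<and>
    (f v < K \<longrightarrow> \<not> rooted_at_top f v \<longrightarrow> f (p v) = Suc (f v) mod K) \<and> (\<exists>n. f ((p ^^ n) v) = K)"
    using ex_pointer_map by blast
  then have p: "\<And>v. v \<in> V \<Longrightarrow> E v (p v)"
    "\<And>v. v \<in> V \<Longrightarrow> f v = K \<Longrightarrow> f (p v) = 0"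
    "\<And>v. v \<in> V \<Longrightarrow> rooted_at_top f v \<Longrightarrow> f (p v) = K"
    "\<And>v. v \<in> V \<Longrightarrow> f v < K \<Longrightarrow> \<not> rooted_at_top f v \<Longrightarrow> f (p v) = Suc (f v) mod K"
    "\<And>v. v \<in> V \<Longrightarrow> \<exists>n. f ((p ^^ n) v) = K"
    by blast+
  have pV: "p v \<in> V" if "v \<in> V" for v using p(1)[OF that] E_V by blast
  obtain w N0 where w: "w \<in> V" "f w = K" "0 < N0" "(p ^^ N0) w = w"
    using ex_periodic_point[of p "\<lambda>v. f v = K", OF pV p(5)] by blast
  \<comment> \<open>With the least period, positions below \<open>N\<close> are distinct vertices,
    so a rule of period \<open>N\<close> is a rule on vertices.\<close>
  define N where "N = (LEAST n. 0 < n \<and> (p ^^ n) w = w)"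
  have N: "0 < N" "(p ^^ N) w = w"
    using LeastI[of "\<lambda>n. 0 < n \<and> (p ^^ n) w = w" N0] w unfolding N_def by blast+
  have N_least: "N \<le> n" if "0 < n" "(p ^^ n) w = w" for n
    using that unfolding N_def by (simp add: Least_le)
  define x where "x i = (p ^^ i) w" for i
  define F where "F i = f (x i)" for i
  define T where "T i = rooted_at_top f (x i)" for i
  define Z where "Z = closes_block F T"
  have xV: "x i \<in> V" for i by (induction i) (use w pV in \<open>auto simp: x_def\<close>)
  have xE: "E (x i) (x (Suc i))" for i using p(1)[OF xV[of i]] by (simp add: x_def)
  have x_add: "x (N + i) = x i" for i
    using N(2) by (simp add: x_def add.commute[of N] funpow_add)
  have x_mod: "x (i mod N) = x i" for i unfolding x_def by (rule funpow_mod_eq[OF N(2)])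
  have x_inj: "i = j" if "x i = x j" "i < N" "j < N" for i j
    using that
  proof (induction i j rule: linorder_wlog)
    case (le i j)
    have "x (i + (N - j)) = x (j + (N - j))"
      using le(2) by (simp only: x_def add.commute[of _ "N - j"] funpow_add comp_apply)
    also have "\<dots> = w" using le N by (simp add: x_def)
    finally have "N \<le> i + (N - j)" using N_least[of "i + (N - j)"] le unfolding x_def by simp
    then show ?case using le by simp
  next
    case (sym i j)
    then show ?case by simp
  qed
  have F: "F i \<le> K" "F i = K \<Longrightarrow> F (Suc i) = 0" "T i \<Longrightarrow> F i = K - 1 \<and> F (Suc i) = K"
    "F i < K \<Longrightarrow> \<not> T i \<Longrightarrow> F (Suc i) = Suc (F i) mod K" for i
    using f xV[of i] p(2-4)[OF xV[of i]] by (auto simp: F_def T_def x_def proper_def rooted_at_top_def)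
  have start: "F (Suc l) = l" if "l < K" for l
    using that
  proof (induction l)
    case 0
    then show ?case using F(2)[of 0] w by (simp add: F_def x_def)
  next
    case (Suc l)
    then have "F (Suc l) = l" "\<not> T (Suc l)" using F(3)[of "Suc l"] by auto
    then show ?case using F(4)[of "Suc l"] Suc.prems by simp
  qed
  have Z_iff: "Z i \<longleftrightarrow> K \<le> i \<and> F i = K - 1 \<and> \<not> T i \<and> F (i - K) \<noteq> K \<and> \<not> Z (i - K)" for i
    unfolding Z_def by (rule closes_block_iff)
  \<comment> \<open>Induction in steps of \<open>K\<close>. The base case relies on starting at
    colour \<open>K\<close>: no position below \<open>K\<close> has colour \<open>K - 1\<close>, so
    \<open>Z\<close> fails there and also one period later.\<close>
  have Z_add: "Z (N + m) = Z m" for m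
  proof (induction m rule: less_induct)
    case (less m)
    show ?case
    proof (cases "K \<le> m")
      case True
      then have "N + m - K = N + (m - K)" by simp
      then have "Z (N + m - K) = Z (m - K)" "F (N + m - K) = F (m - K)"
        using less[of "m - K"] True K2 by (simp_all only: F_def x_add)
      moreover have "F (N + m) = F m" "T (N + m) = T m" "K \<le> N + m"
        using True by (simp_all add: F_def T_def x_add)
      ultimately show ?thesis using True Z_iff[of m] Z_iff[of "N + m"] by metis
    next
      case False
      have "F m \<noteq> K - 1"
      proof (cases m)
        case 0
        then show ?thesis using w K2 by (simp add: F_def x_def)
      next
        case (Suc l)
        then show ?thesis using start[of l] False by simp
      qed
      then show ?thesis using Z_iff[of m] Z_iff[of "N + m"] by (simp add: F_def x_add)
    qed
  qed
  have Z_mod: "Z (i mod N) = Z i" for i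
  proof -
    have "Z (q * N + m) = Z m" for q m
      by (induction q) (simp_all add: Z_add add.assoc)
    from this[of "i div N" "i mod N"] show ?thesis by simp
  qed
  have Z_x: "Z i = Z j" if "x i = x j" for i j
    using x_inj[of "i mod N" "j mod N"] x_mod Z_mod N(1) that by (metis mod_less_divisor)
  define g where "g v = (if \<exists>i. v = x i \<and> Z i then K else f v)" for v
  have gx: "g (x i) = (if Z i then K else F i)" for i
  proof -
    have "(\<exists>j. x i = x j \<and> Z j) = Z i"
    proof
      assume "\<exists>j. x i = x j \<and> Z j"
      then obtain j where "x i = x j" "Z j" by (elim exE conjE)
      then show "Z i" using Z_x[of i j] by (simp only:)
    qed (intro exI[of _ i] conjI refl)
    then show ?thesis unfolding g_def F_def by (simp only:)
  qed
  \<comment> \<open>Recoloured vertices all had colour \<open>K - 1\<close>, so no two are adjacent;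
    none is \<open>rooted_at_top\<close>, so none has a neighbour of original colour
    \<open>K\<close>.\<close>
  have half: "g u \<noteq> g v" if uv: "E u v" "\<exists>i. u = x i \<and> Z i" for u v
  proof -
    obtain i where i: "u = x i" "Z i" using uv by blast
    then have fu: "f u = K - 1" "\<not> rooted_at_top f u" using Z_iff[of i] by (auto simp: F_def T_def)
    have gu: "g u = K" using i gx by simp
    show ?thesis
    proof (cases "\<exists>j. v = x j \<and> Z j")
      case True
      then obtain j where "v = x j" "Z j" by blast
      then have "f v = f u" using Z_iff[of j] fu by (simp add: F_def)
      then show ?thesis using f uv unfolding proper_def by metis
    next
      case False
      then have "g v = f v" unfolding g_def by (rule if_not_P)
      moreover have "f v \<noteq> K" using fu uv(1) by (auto simp: rooted_at_top_def)
      ultimately show ?thesis using gu by simp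
    qed
  qed
  have g_edge: "g u \<noteq> g v" if uv: "E u v" for u v
  proof (cases "(\<exists>i. u = x i \<and> Z i) \<or> (\<exists>i. v = x i \<and> Z i)")
    case True
    then show ?thesis
    proof
      assume "\<exists>i. u = x i \<and> Z i"
      then show ?thesis by (rule half[OF uv])
    next
      assume "\<exists>i. v = x i \<and> Z i"
      then show ?thesis by (rule half[OF E_sym[OF uv], THEN not_sym])
    qed
  next
    case False
    then have "g u = f u" "g v = f v" unfolding g_def by (simp_all only: if_False simp_thms de_Morgan_disj)
    then show ?thesis using f uv by (simp add: proper_def)
  qed
  have "g v \<le> K" if "v \<in> V" for v using f that by (simp add: g_def proper_def)
  then have "proper g" using g_edge by (simp add: proper_def)
  \<comment> \<open>\<open>block_recolouring\<close> asks for a position of at least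
    \<open>K\<close>; adding \<open>K * N\<close> provides one for every vertex of the
    cycle.\<close>
  define idx where "idx v = (SOME i. v = x i \<and> K \<le> i)" for v
  have idx: "v = x (idx v) \<and> K \<le> idx v" if v: "v \<in> range x" for v
  proof -
    obtain i where i: "v = x i" using v by blast
    have "x (i + K * N) = x i" using x_mod[of "i + K * N"] x_mod[of i] by simp
    moreover have "K \<le> i + K * N" using N(1) by (simp add: trans_le_add2)
    ultimately have "v = x (i + K * N) \<and> K \<le> i + K * N" using i by simp
    then show ?thesis unfolding idx_def by (rule someI)
  qed
  define W where "W v j = x (idx v + j)" for v j
  have gx': "g (x i) = (if closes_block F T i then K else F i)" for i using gx[of i] by (simp only: Z_def)
  have block: "(wide (\<lambda>j. g (x (i + j))) \<or> narrow 0 (\<lambda>j. g (x (i + j))) \<or> narrow 1 (\<lambda>j. g (x (i + j))))"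
    (is "?A i") "\<exists>m j. i = m + j \<and> j \<le> K \<and> inj_on (\<lambda>j. g (x (m + j))) {..K}" (is "?B i") if "K \<le> i" for i
  proof -
    show "?A i"
      by (rule block_recolouring(1)[where F = F and T = T and G = "\<lambda>i. g (x i)" and i = i]) (rule F(1), erule F(2), erule F(3), erule (1) F(4), rule gx', rule that)
    show "?B i"
      by (rule block_recolouring(2)[where F = F and T = T and G = "\<lambda>i. g (x i)" and i = i]) (rule F(1), erule F(2), erule F(3), erule (1) F(4), rule gx', rule that)
  qed
  have "\<exists>t. walk g t (W v)" if v: "v \<in> range x" for v
  proof -
    have "wide (\<lambda>j. g (W v j)) \<or> narrow 0 (\<lambda>j. g (W v j)) \<or> narrow 1 (\<lambda>j. g (W v j))"
      using block(1)[of "idx v"] idx[OF v] unfolding W_def by blast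
    then show ?thesis
    proof (elim disjE)
      assume "wide (\<lambda>j. g (W v j))"
      then show ?thesis using xE by (intro exI[of _ 2]) (simp add: walk_def W_def)
    next
      assume "narrow 0 (\<lambda>j. g (W v j))"
      then show ?thesis using xE by (intro exI[of _ 0]) (simp add: walk_def W_def)
    next
      assume "narrow 1 (\<lambda>j. g (W v j))"
      then show ?thesis using xE by (intro exI[of _ 1]) (simp add: walk_def W_def)
    qed
  qed
  then obtain ty where ty: "\<And>v. v \<in> range x \<Longrightarrow> walk g (ty v) (W v)" by metis
  have on_full: "\<exists>P. full g P \<and> range P \<subseteq> range x \<and> v \<in> P ` {..K}" if v: "v \<in> range x" for v
  proof -
    obtain m j where "idx v = m + j" "j \<le> K" "inj_on (\<lambda>j. g (x (m + j))) {..K}"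
      using block(2)[of "idx v"] idx[OF v] by blast
    then have "full g (\<lambda>j. x (m + j))" "v = x (m + j)" "j \<in> {..K}"
      using idx[OF v] xE by (auto simp: full_def)
    then show ?thesis by (intro exI[of _ "\<lambda>j. x (m + j)"] conjI) auto
  qed
  have W0: "W v 0 = v" if "v \<in> range x" for v
    using idx[OF that, THEN conjunct1, symmetric] by (simp add: W_def)
  have W_range: "range (W v) \<subseteq> range x" for v by (auto simp: W_def)
  show ?thesis
  proof (rule that[of g "range x" W ty])
    show "proper g" by fact
    show "range x \<noteq> {}" "range x \<subseteq> V" using xV by auto
    show "\<And>v. v \<in> range x \<Longrightarrow> W v 0 = v \<and> range (W v) \<subseteq> range x \<and> walk g (ty v) (W v)"
      by (intro conjI W0 W_range ty)
    show "\<And>v. v \<in> range x \<Longrightarrow> \<exists>P. full g P \<and> range P \<subseteq> range x \<and> v \<in> P ` {..K}"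
      by (rule on_full)
  qed
qed


section \<open>Prepending a vertex to a walk\<close>

lemma wideD: "wide c \<Longrightarrow> j \<le> K \<Longrightarrow> c j = (c 0 + j) mod Suc K"
  unfolding wide_def by blast

lemma narrowD: "narrow t c \<Longrightarrow> j < K \<Longrightarrow> rot t (c j) = (rot t (c 0) + j) mod K"
  unfolding narrow_def by blast

text \<open>Adding \<open>K\<close> modulo \<open>Suc K\<close> is subtracting one, so
  \<open>a\<close> is the cyclic predecessor of the first colour.\<close>

lemma wide_case_nat:
  assumes "wide c" "a = (c 0 + K) mod Suc K"
  shows "wide (case_nat a c)"
  unfolding wide_def
proof (intro allI impI)
  fix j assume "j \<le> K"
  show "case_nat a c j = (case_nat a c 0 + j) mod Suc K"
  proof (cases j)
    case 0
    then show ?thesis using assms(2) by simp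
  next
    case (Suc l)
    then have "c l = (c 0 + l) mod Suc K" using wideD[OF assms(1), of l] \<open>j \<le> K\<close> by simp
    also have "\<dots> = (c 0 + l + Suc K) mod Suc K" by (rule mod_add_self2[symmetric])
    also have "c 0 + l + Suc K = c 0 + K + Suc l" by simp
    also have "(c 0 + K + Suc l) mod Suc K = (a + Suc l) mod Suc K" unfolding assms(2) by (simp only: mod_add_left_eq)
    finally show ?thesis using Suc by simp
  qed
qed

lemma rot_pred: "rot t ((b + K) mod Suc K) = (rot t b + K) mod Suc K"
  unfolding rot_def by (simp only: mod_add_left_eq) (simp add: add_ac)

lemma rot_inject:
  assumes "rot t (a + n) = rot t (b + m)"
  shows "(a + n) mod Suc K = (b + m) mod Suc K"
proof -
  obtain q r where "a + n + t + Suc K * q = b + m + t + Suc K * r"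
    using assms nat_mod_eq_iff unfolding rot_def by blast
  then have "a + n + Suc K * q = b + m + Suc K * r" by linarith
  then show ?thesis by (metis mod_mult_self2)
qed

lemma narrow_less:
  assumes "narrow t c"
  shows "rot t (c 0) < K"
proof -
  have "rot t (c 0) = rot t (c 0) mod K" using narrowD[OF assms, of 0] K2 by simp
  also have "\<dots> < K" using K2 by simp
  finally show ?thesis .
qed

text \<open>\<open>rot t\<close> sends \<open>a\<close> to \<open>K\<close>, the one value missing
  from the first \<open>K\<close> rotated colours of \<open>c\<close>. Prepending \<open>a\<close>
  therefore completes them to a cyclic order of all \<open>K + 1\<close> colours.\<close>

lemma narrow_case_nat_wide:
  assumes c: "narrow t c" "rot t (c 0) = 0" "\<And>l. c l \<le> K" and a: "a = (c 0 + K) mod Suc K"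
  shows "wide (case_nat a c)"
  unfolding wide_def
proof (intro allI impI)
  fix j assume "j \<le> K"
  have rot_a: "rot t a = K" unfolding a rot_pred c(2) by simp
  show "case_nat a c j = (case_nat a c 0 + j) mod Suc K"
  proof (cases j)
    case 0
    then show ?thesis using a by simp
  next
    case (Suc l)
    then have "rot t (c l) = l" using narrowD[OF c(1), of l] c(2) \<open>j \<le> K\<close> by simp
    moreover have "rot t (a + Suc l) = (rot t a + Suc l) mod Suc K"
      unfolding rot_def by (simp only: mod_add_left_eq) (simp add: add_ac)
    moreover have "\<dots> = l" using rot_a Suc \<open>j \<le> K\<close> mod_add_self1[of "Suc K" l] by simp
    ultimately have "(c l + 0) mod Suc K = (a + Suc l) mod Suc K" by (intro rot_inject[of t]) simp
    then show ?thesis using Suc c(3)[of l] by simp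
  qed
qed

text \<open>Away from rotated colour \<open>0\<close>, predecessors modulo \<open>K\<close> and
  modulo \<open>Suc K\<close> coincide. The second claim is the descent recorded in
  \<open>grown\<close>.\<close>

lemma narrow_case_nat:
  assumes c: "narrow t c" "rot t (c 0) \<noteq> 0" and a: "a = (c 0 + K) mod Suc K"
  shows "narrow t (case_nat a c)" and "Suc (rot t a) = rot t (c 0)"
proof -
  obtain r where r: "rot t (c 0) = Suc r" using c(2) not0_implies_Suc by blast
  moreover have "Suc r < K" using narrow_less[OF c(1)] r by simp
  moreover have "rot t a = (r + Suc K) mod Suc K" unfolding a rot_pred r by simp
  ultimately have ra: "rot t a = r" by (metis Suc_lessD less_SucI mod_add_self2 mod_less)
  then show "Suc (rot t a) = rot t (c 0)" using r by simp
  show "narrow t (case_nat a c)"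
    unfolding narrow_def
  proof (intro allI impI)
    fix j assume "j < K"
    then show "rot t (case_nat a c j) = (rot t (case_nat a c 0) + j) mod K"
      using narrowD[OF c(1), of "j - 1"] r ra \<open>Suc r < K\<close> by (cases j) simp_all
  qed
qed

lemma walk_cong:
  assumes "\<And>i. g (w i) = h (w i)" "walk g t w"
  shows "walk h t w"
  using assms(2) unfolding walk_def assms(1) .

lemma walk_case_nat:
  assumes w: "walk g t w" "\<And>i. g (w i) \<le> K" and s: "E s (w 0)" "g s = (g (w 0) + K) mod Suc K"
  shows "walk g (if t = 2 \<or> rot t (g (w 0)) = 0 then 2 else t) (case_nat s w)"
proof -
  have c: "(\<lambda>i. g (case_nat s w i)) = case_nat (g s) (\<lambda>i. g (w i))"
    by (auto split: nat.split)
  have E1: "E (case_nat s w i) (case_nat s w (Suc i))" if "i < n" "\<forall>i. Suc i < n \<longrightarrow> E (w i) (w (Suc i))" for i n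
    using that s(1) by (cases i) auto
  show ?thesis
  proof (cases "t = 2")
    case True
    then have "wide (\<lambda>i. g (w i))" "\<forall>i<K. E (w i) (w (Suc i))" using w(1) by (auto simp: walk_def)
    then show ?thesis using wide_case_nat[of "\<lambda>i. g (w i)" "g s"] s E1[of _ K] True
      by (simp add: walk_def c)
  next
    case False
    then have t: "t < 2" "narrow t (\<lambda>i. g (w i))" "\<forall>i. Suc i < K \<longrightarrow> E (w i) (w (Suc i))"
      using w(1) by (auto simp: walk_def)
    show ?thesis
    proof (cases "rot t (g (w 0)) = 0")
      case True
      then show ?thesis using narrow_case_nat_wide[OF t(2)] w(2) s E1[of _ K] t(3) by (simp add: walk_def c)
    next
      case rot: False
      then have "narrow t (case_nat (g s) (\<lambda>i. g (w i)))" using narrow_case_nat(1)[OF t(2)] s by simp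
      then show ?thesis using rot False t E1[of _ K] by (simp add: walk_def c)
    qed
  qed
qed

section \<open>Attaching all remaining vertices to the core\<close>

text \<open>
  \<open>X0\<close> is the core and \<open>P\<close> the set of pending vertices, those outside the core whose walk is narrow. The last clause
  says that a pending vertex on the walk of another vertex has a child. Along children the rotated colour
  decreases, which later guarantees that a vertex is not dropped from the end of the walks of its descendants.
\<close>

definition grown where
  "grown g0 X0 g X W ty P \<longleftrightarrow> proper g \<and> X0 \<subseteq> X \<and> X \<subseteq> V \<and> P \<subseteq> X - X0 \<and> (\<forall>x\<in>X0. g x = g0 x) \<and>
     (\<forall>x\<in>X. W x 0 = x \<and> range (W x) \<subseteq> X \<and> walk g (ty x) (W x)) \<and>
     (\<forall>x\<in>X - X0 - P. ty x = 2) \<and>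
     (\<forall>r\<in>P. ty r < (2::nat) \<and> (\<exists>x\<in>X. x \<noteq> r \<and> E r x \<and> W r = case_nat r (W x) \<and> ty x = ty r \<and>
        Suc (rot (ty r) (g r)) = rot (ty r) (g x))) \<and>
     (\<forall>p\<in>P. (\<exists>x\<in>X. x \<noteq> p \<and> p \<in> range (W x)) \<longrightarrow> (\<exists>r\<in>X. W r = case_nat r (W p) \<and>
        (ty r = 2 \<or> r \<in> P \<and> ty r = ty p \<and> Suc (rot (ty p) (g r)) = rot (ty p) (g p))))"

text \<open>\<open>V - X\<close> is rotated modulo \<open>Suc K\<close> until some \<open>s\<close>
  has the colour just before that of a neighbour \<open>u\<close> in \<open>X\<close>; then
  \<open>s\<close> is put in front of \<open>W u\<close>. Colours in \<open>X\<close> do not change,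
  so the earlier walks stay valid.\<close>

lemma grown_step:
  assumes G: "grown g0 X0 g X W ty P" and X: "X \<noteq> {}" "X \<noteq> V"
  obtains h s W' ty' P' where "s \<in> V - X" "grown g0 X0 h (insert s X) W' ty' P'"
proof -
  note grown = G[unfolded grown_def]
  have pg: "proper g" using grown by (elim conjE)
  have X0: "X0 \<subseteq> X" using grown by (elim conjE)
  have XV: "X \<subseteq> V" using grown by (elim conjE)
  have PX: "P \<subseteq> X - X0" using grown by (elim conjE)
  have g0: "\<forall>x\<in>X0. g x = g0 x" using grown by (elim conjE)
  have G_walk: "\<forall>x\<in>X. W x 0 = x \<and> range (W x) \<subseteq> X \<and> walk g (ty x) (W x)" using grown by (elim conjE)
  have G_wide: "\<forall>x\<in>X - X0 - P. ty x = 2" using grown by (elim conjE)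
  have G_parent: "\<forall>r\<in>P. ty r < 2 \<and> (\<exists>x\<in>X. x \<noteq> r \<and> E r x \<and> W r = case_nat r (W x) \<and> ty x = ty r \<and>
        Suc (rot (ty r) (g r)) = rot (ty r) (g x))" using grown by (elim conjE)
  have G_child: "\<forall>p\<in>P. (\<exists>x\<in>X. x \<noteq> p \<and> p \<in> range (W x)) \<longrightarrow> (\<exists>r\<in>X. W r = case_nat r (W p) \<and>
        (ty r = 2 \<or> r \<in> P \<and> ty r = ty p \<and> Suc (rot (ty p) (g r)) = rot (ty p) (g p)))" using grown by (elim conjE)
  obtain s0 u0 where e0: "s0 \<in> V - X" "u0 \<notin> V - X" "E s0 u0"
    using cut[of "V - X"] XV X by blast
  have "\<exists>h. (\<forall>v. v \<notin> V - X \<longrightarrow> h v = g v) \<and> (\<forall>v\<in>V - X. h v < Suc K) \<and> (\<forall>u v. E u v \<longrightarrow> h u \<noteq> h v) \<and>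
    (\<exists>s u. s \<in> V - X \<and> u \<notin> V - X \<and> E s u \<and> h s = (g u + K) mod Suc K)"
    using e0 pg E_sym by (intro colour_rotation[of E g "V - X" "Suc K" s0 u0]) (auto simp: proper_def less_Suc_eq_le)
  then obtain h s u where h: "\<And>v. v \<notin> V - X \<Longrightarrow> h v = g v" "\<And>v. v \<in> V - X \<Longrightarrow> h v < Suc K"
    "\<And>u v. E u v \<Longrightarrow> h u \<noteq> h v"
    and su: "s \<in> V - X" "u \<notin> V - X" "E s u" "h s = (g u + K) mod Suc K"
    by blast
  have uX: "u \<in> X" using su E_V by blast
  have sX: "s \<notin> X" using su by blast
  have hX: "h x = g x" if "x \<in> X" for x using h(1) that by blast
  have ph: "proper h" using h pg unfolding proper_def by (metis less_Suc_eq_le)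
  have WX: "W x 0 = x" "W x i \<in> X" "walk h (ty x) (W x)" if "x \<in> X" for x i
  proof -
    have x: "W x 0 = x" "range (W x) \<subseteq> X" "walk g (ty x) (W x)" using G_walk that by blast+
    then show "W x 0 = x" "W x i \<in> X" by auto
    show "walk h (ty x) (W x)" by (rule walk_cong[OF _ x(3)]) (metis hX rangeI subsetD x(2))
  qed
  \<comment> \<open>Here the walk of \<open>s\<close> is wide, because \<open>W u\<close> is or
    because \<open>s\<close> supplies the colour that \<open>W u\<close> omits. Otherwise
    \<open>s\<close> becomes pending.\<close>
  define top where "top \<longleftrightarrow> ty u = 2 \<or> rot (ty u) (h u) = 0"
  define W' where "W' = W(s := case_nat s (W u))"
  define ty' where "ty' = ty(s := if top then 2 else ty u)"
  define P' where "P' = (if top then P else insert s P)"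
  have old: "W' x = W x" "ty' x = ty x" "x \<noteq> s" if "x \<in> X" for x
    using that sX by (auto simp: W'_def ty'_def)
  have W's: "W' s = case_nat s (W u)" "ty' s = (if top then 2 else ty u)" by (simp_all add: W'_def ty'_def)
  have hu: "h u = g u" "h (W u 0) = g u" using hX uX WX(1)[OF uX] by simp_all
  have "h (W u i) \<le> K" for i using WX(2)[OF uX] XV ph unfolding proper_def by blast
  then have ws: "walk h (ty' s) (W' s)"
    unfolding W's top_def using walk_case_nat[OF WX(3)[OF uX], of s] su(3,4) hu WX(1)[OF uX] by simp
  have s_rot: "Suc (rot (ty u) (h s)) = rot (ty u) (h u)" "ty u < 2" if "\<not> top"
  proof -
    have "narrow (ty u) (\<lambda>i. h (W u i))" and "ty u < 2" using WX(3)[OF uX] that by (auto simp: top_def walk_def)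
    then show "Suc (rot (ty u) (h s)) = rot (ty u) (h u)" "ty u < 2"
      using narrow_case_nat(2)[of "ty u" "\<lambda>i. h (W u i)" "h s"] that su hu WX(1)[OF uX] by (auto simp: top_def)
  qed
  have parent: "\<exists>x\<in>insert s X. x \<noteq> r \<and> E r x \<and> W' r = case_nat r (W' x) \<and> ty' x = ty' r \<and>
        Suc (rot (ty' r) (h r)) = rot (ty' r) (h x)" "ty' r < 2" if "r \<in> P'" for r
  proof -
    have "(\<exists>x\<in>insert s X. x \<noteq> r \<and> E r x \<and> W' r = case_nat r (W' x) \<and> ty' x = ty' r \<and>
        Suc (rot (ty' r) (h r)) = rot (ty' r) (h x)) \<and> ty' r < 2"
    proof (cases "r = s")
      case True
      then have "\<not> top" using that PX sX by (auto simp: P'_def split: if_splits)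
      then show ?thesis using True s_rot su uX old[OF uX] W's by auto
    next
      case False
      then have r: "r \<in> P" "r \<in> X" using that PX by (auto simp: P'_def split: if_splits)
      then obtain x where "ty r < 2" "x \<in> X" "x \<noteq> r" "E r x" "W r = case_nat r (W x)" "ty x = ty r"
        "Suc (rot (ty r) (g r)) = rot (ty r) (g x)" using G_parent by blast
      then show ?thesis using old[of x] old[of r] r hX by auto
    qed
    then show "\<exists>x\<in>insert s X. x \<noteq> r \<and> E r x \<and> W' r = case_nat r (W' x) \<and> ty' x = ty' r \<and>
        Suc (rot (ty' r) (h r)) = rot (ty' r) (h x)" "ty' r < 2" by blast+
  qed
  have child: "\<exists>r\<in>insert s X. W' r = case_nat r (W' p) \<and>
        (ty' r = 2 \<or> r \<in> P' \<and> ty' r = ty' p \<and> Suc (rot (ty' p) (h r)) = rot (ty' p) (h p))"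
    if p: "p \<in> P'" and x: "x \<in> insert s X" "x \<noteq> p" "p \<in> range (W' x)" for p x
  proof -
    have "p \<noteq> s"
    proof
      assume "p = s"
      then show False using x old[of x] WX(2)[of x] sX by auto
    qed
    then have p: "p \<in> P" "p \<in> X" using that(1) PX by (auto simp: P'_def split: if_splits)
    \<comment> \<open>If \<open>p\<close> is \<open>u\<close> and the walk is the new one,
      \<open>s\<close> is the child. Otherwise \<open>p\<close> already lies on the walk of another
      old vertex (of \<open>u\<close>, if \<open>x = s\<close>) and keeps its child.\<close>
    show ?thesis
    proof (cases "p = u \<and> x = s")
      case True
      then have "ty p < 2" using p G_parent by blast
      then show ?thesis using True W's old[OF uX] s_rot by (intro bexI[of _ s]) (auto simp: P'_def)
    next
      case False
      obtain y where y: "y \<in> X" "y \<noteq> p" "p \<in> range (W y)"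
      proof (cases "x = s")
        case True
        then have "p \<in> range (W u)" using x W's \<open>p \<noteq> s\<close> by (auto split: nat.splits)
        then show ?thesis using that[of u] uX False True by auto
      next
        case False
        then show ?thesis using that[of x] x old[of x] by auto
      qed
      then obtain r where "r \<in> X" "W r = case_nat r (W p)"
        "ty r = 2 \<or> r \<in> P \<and> ty r = ty p \<and> Suc (rot (ty p) (g r)) = rot (ty p) (g p)"
        using G_child p by blast
      then show ?thesis using old[of r] old[of p] p hX by (intro bexI[of _ r]) (auto simp: P'_def)
    qed
  qed
  have "grown g0 X0 h (insert s X) W' ty' P'"
    unfolding grown_def
  proof (intro conjI ballI impI)
    show "proper h" by fact
    show "X0 \<subseteq> insert s X" "insert s X \<subseteq> V" using X0 XV su by auto
    show "P' \<subseteq> insert s X - X0" using PX sX X0 by (auto simp: P'_def)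
    show "h x = g0 x" if "x \<in> X0" for x using that g0 hX X0 by auto
    show "W' x 0 = x" if "x \<in> insert s X" for x
      using that W's WX(1) old by auto
    show "range (W' x) \<subseteq> insert s X" if "x \<in> insert s X" for x
      using that W's WX(2) uX old by (auto split: nat.splits)
    show "walk h (ty' x) (W' x)" if "x \<in> insert s X" for x
      using that ws WX(3) old by auto
    show "ty' x = 2" if "x \<in> insert s X - X0 - P'" for x
      using that G_wide W's old(2)[of x] by (auto simp: P'_def split: if_splits)
    show "ty' r < 2" if "r \<in> P'" for r using parent that by blast
    show "\<exists>x\<in>insert s X. x \<noteq> r \<and> E r x \<and> W' r = case_nat r (W' x) \<and> ty' x = ty' r \<and>
        Suc (rot (ty' r) (h r)) = rot (ty' r) (h x)" if "r \<in> P'" for r by (rule parent[OF that])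
    show "\<exists>r\<in>insert s X. W' r = case_nat r (W' p) \<and>
        (ty' r = 2 \<or> r \<in> P' \<and> ty' r = ty' p \<and> Suc (rot (ty' p) (h r)) = rot (ty' p) (h p))"
      if "p \<in> P'" "\<exists>x\<in>insert s X. x \<noteq> p \<and> p \<in> range (W' x)" for p
      using child that by blast
  qed
  then show ?thesis using that su by blast
qed

lemma ex_grown:
  assumes "grown g0 X0 g X W ty P" "X \<noteq> {}"
  shows "\<exists>h W ty P. grown g0 X0 h V W ty P"
  using assms
proof (induction "card (V - X)" arbitrary: g X W ty P rule: less_induct)
  case less
  show ?case
  proof (cases "X = V")
    case True
    then show ?thesis using less.prems by blast
  next
    case False
    then obtain h s W' ty' P' where s: "s \<in> V - X" "grown g0 X0 h (insert s X) W' ty' P'"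
      using grown_step[OF less.prems] by metis
    moreover have "card (V - insert s X) < card (V - X)"
      using s finite_V by (intro psubset_card_mono) auto
    ultimately show ?thesis using less.hyps[of "insert s X"] by blast
  qed
qed


section \<open>Recolouring the leaves\<close>

text \<open>Choose a largest subset of \<open>L\<close> that can take colour \<open>c\<close> as a
  whole; a remaining vertex that saw no \<open>c\<close> could be added.\<close>

lemma maximal_recolouring:
  assumes g: "proper g" and c: "c \<le> K" and L: "L \<subseteq> V"
  obtains h Q where "Q \<subseteq> L" "proper h" "\<And>v. v \<in> Q \<Longrightarrow> h v = c" "\<And>v. v \<notin> Q \<Longrightarrow> h v = g v"
    "\<And>q. q \<in> L \<Longrightarrow> q \<notin> Q \<Longrightarrow> \<exists>v. E q v \<and> h v = c"
proof -
  define col where "col Q v = (if v \<in> Q then c else g v)" for Q v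
  define ok where "ok Q \<longleftrightarrow> Q \<subseteq> L \<and> proper (col Q)" for Q
  have finL: "finite L" using L finite_V by (rule finite_subset)
  have "col {} = g" by (simp add: col_def fun_eq_iff)
  then have "ok {}" using g by (simp add: ok_def)
  moreover have "card Q < Suc (card L)" if "ok Q" for Q
    using that finL by (simp add: ok_def card_mono less_Suc_eq_le)
  ultimately obtain Q where Q: "ok Q" and max: "\<And>R. ok R \<Longrightarrow> card R \<le> card Q"
    using ex_has_greatest_nat[of ok "{}" card "Suc (card L)"] by blast
  have "\<exists>v. E q v \<and> col Q v = c" if q: "q \<in> L" "q \<notin> Q" for q
  proof (rule ccontr)
    assume no: "\<not> ?thesis"
    have "col (insert q Q) u \<noteq> col (insert q Q) v" if uv: "E u v" for u v
    proof -
      have "col Q u \<noteq> col Q v" using Q uv by (simp add: ok_def proper_def)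
      moreover have "u = q \<Longrightarrow> col Q v \<noteq> c \<and> v \<noteq> q" "v = q \<Longrightarrow> col Q u \<noteq> c \<and> u \<noteq> q"
        using no uv E_sym[OF uv] E_irrefl by auto
      ultimately show ?thesis by (cases "u = q"; cases "v = q") (auto simp: col_def)
    qed
    moreover have "col (insert q Q) v \<le> K" if "v \<in> V" for v
      using that c g by (simp add: col_def proper_def)
    ultimately have "ok (insert q Q)" using q Q by (simp add: ok_def proper_def)
    then have "card (insert q Q) \<le> card Q" by (rule max)
    moreover have "finite Q" using Q finL finite_subset by (auto simp: ok_def)
    ultimately show False using q by simp
  qed
  then show ?thesis using that[of Q "col Q"] Q by (simp add: ok_def col_def)
qed

lemma full_cong:
  assumes "\<And>i. i \<le> K \<Longrightarrow> g (P i) = h (P i)" "full g P"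
  shows "full h P"
  using assms by (auto simp: full_def inj_on_def)

lemma full_wide: "walk g 2 w \<Longrightarrow> full g w"
  using wide_inj[of "\<lambda>i. g (w i)"] by (simp add: walk_def full_def)

text \<open>The rotated colours of the first \<open>K\<close> entries are exactly the values below
  \<open>K\<close>, so \<open>s\<close> brings in the only missing colour.\<close>

lemma full_narrow:
  assumes w: "walk g t w" "t < 2" and s: "E s (w 0)" "rot t (g s) = K"
  shows "full g (case_nat s w)"
proof -
  have w': "narrow t (\<lambda>i. g (w i))" "\<And>i. Suc i < K \<Longrightarrow> E (w i) (w (Suc i))"
    using w by (auto simp: walk_def)
  have "E (case_nat s w i) (case_nat s w (Suc i))" if "i < K" for i
    using that s(1) w'(2) by (cases i) auto
  moreover have "inj_on (\<lambda>i. g (case_nat s w i)) {..K}"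
  proof (rule inj_onI)
    fix i j assume ij: "i \<in> {..K}" "j \<in> {..K}" "g (case_nat s w i) = g (case_nat s w j)"
    have rw: "rot t (g (w l)) = (rot t (g (w 0)) + l) mod K" if "l < K" for l
      using narrowD[OF w'(1) that] .
    have lt: "rot t (g (w l)) < K" if "l < K" for l
      using rw[OF that] K2 by simp
    have inj: "l = m" if lm: "l < K" "m < K" "g (w l) = g (w m)" for l m
    proof -
      have "(rot t (g (w 0)) + l) mod K = (rot t (g (w 0)) + m) mod K" using rw lm by metis
      then obtain q r where "rot t (g (w 0)) + l + K * q = rot t (g (w 0)) + m + K * r"
        using nat_mod_eq_iff by blast
      then have "l + K * q = m + K * r" by linarith
      then show ?thesis using lm by (metis mod_less mod_mult_self2)
    qed
    show "i = j"
    proof (cases i)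
      case 0
      then show ?thesis using ij s(2) lt[of "j - 1"] by (cases j) auto
    next
      case (Suc l)
      then show ?thesis using ij s(2) lt[of l] inj[of l "j - 1"] by (cases j) auto
    qed
  qed
  ultimately show ?thesis by (simp add: full_def)
qed

text \<open>Only leaves change colour: pending vertices on no walk but their own. Hence the core
  paths and the walks of all other vertices keep their colours. A leaf either takes the colour its
  walk omits or has a neighbour of that colour to put in front; both ways the first \<open>K\<close>
  entries of its walk lie on a full path. Any other pending vertex lies on the walk of a suitable
  descendant.\<close>

lemma ex_full_colouring: "\<exists>h. proper h \<and> (\<forall>v\<in>V. \<exists>P. full h P \<and> v \<in> P ` {..K})"
proof -
  obtain g0 X0 W0 ty0 where core: "proper g0" "X0 \<noteq> {}" "X0 \<subseteq> V"
    "\<And>x. x \<in> X0 \<Longrightarrow> W0 x 0 = x \<and> range (W0 x) \<subseteq> X0 \<and> walk g0 (ty0 x) (W0 x)"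
    and core_full: "\<And>x. x \<in> X0 \<Longrightarrow> \<exists>P. full g0 P \<and> range P \<subseteq> X0 \<and> x \<in> P ` {..K}"
    using ex_core by metis
  have "grown g0 X0 g0 X0 W0 ty0 {}" using core by (simp add: grown_def)
  then obtain g W ty P where "grown g0 X0 g V W ty P" using ex_grown core(2) by blast
  note grown = this[unfolded grown_def]
  have pg: "proper g" using grown by (elim conjE)
  have PV: "P \<subseteq> V - X0" using grown by (elim conjE)
  have g0: "\<forall>x\<in>X0. g x = g0 x" using grown by (elim conjE)
  have G_walk: "\<forall>x\<in>V. W x 0 = x \<and> range (W x) \<subseteq> V \<and> walk g (ty x) (W x)" using grown by (elim conjE)
  have G_wide: "\<forall>x\<in>V - X0 - P. ty x = 2" using grown by (elim conjE)
  have G_parent: "\<forall>r\<in>P. ty r < 2 \<and> (\<exists>x\<in>V. x \<noteq> r \<and> E r x \<and> W r = case_nat r (W x) \<and> ty x = ty r \<and>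
        Suc (rot (ty r) (g r)) = rot (ty r) (g x))" using grown by (elim conjE)
  have G_child: "\<forall>p\<in>P. (\<exists>x\<in>V. x \<noteq> p \<and> p \<in> range (W x)) \<longrightarrow> (\<exists>r\<in>V. W r = case_nat r (W p) \<and>
        (ty r = 2 \<or> r \<in> P \<and> ty r = ty p \<and> Suc (rot (ty p) (g r)) = rot (ty p) (g p)))" using grown by (elim conjE)
  have W0: "W x 0 = x" and WV: "W x i \<in> V" and W_walk: "walk g (ty x) (W x)" if "x \<in> V" for x i
    using G_walk that by blast+
  define leaf where "leaf p \<longleftrightarrow> p \<in> P \<and> (\<forall>x\<in>V. p \<in> range (W x) \<longrightarrow> x = p)" for p
  define L where "L t = {p. leaf p \<and> ty p = t}" for t
  have LV: "L t \<subseteq> V" for t using PV by (auto simp: L_def leaf_def)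
  obtain g1 Q1 where 1: "Q1 \<subseteq> L 1" "proper g1" "\<And>v. v \<in> Q1 \<Longrightarrow> g1 v = K - 1" "\<And>v. v \<notin> Q1 \<Longrightarrow> g1 v = g v"
    "\<And>q. q \<in> L 1 \<Longrightarrow> q \<notin> Q1 \<Longrightarrow> \<exists>v. E q v \<and> g1 v = K - 1"
    using maximal_recolouring[OF pg _ LV, of "K - 1" 1] by (metis diff_le_self)
  obtain h Q0 where 2: "Q0 \<subseteq> L 0" "proper h" "\<And>v. v \<in> Q0 \<Longrightarrow> h v = K" "\<And>v. v \<notin> Q0 \<Longrightarrow> h v = g1 v"
    "\<And>q. q \<in> L 0 \<Longrightarrow> q \<notin> Q0 \<Longrightarrow> \<exists>v. E q v \<and> h v = K"
    using maximal_recolouring[OF 1(2) _ LV, of K 0] by (metis order_refl)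
  have keep: "h v = g v" if "\<not> leaf v" for v
  proof -
    have "v \<notin> Q1" "v \<notin> Q0" using that 1(1) 2(1) by (auto simp: L_def)
    then show ?thesis using 1(4) 2(4) by simp
  qed
  have inner: "\<not> leaf (W x i)" if "x \<in> V" "\<not> leaf x" for x i
  proof
    assume "leaf (W x i)"
    then have "x = W x i" using that(1) unfolding leaf_def by blast
    then show False using that(2) \<open>leaf (W x i)\<close> by simp
  qed
  have wide_full: "full h (W x)" if "x \<in> V" "ty x = 2" for x
  proof -
    have "\<not> leaf x" using that G_parent by (auto simp: leaf_def)
    then have "g (W x i) = h (W x i)" for i using keep inner[OF that(1)] by simp
    moreover have "full g (W x)" using W_walk[OF that(1)] that(2) full_wide by simp
    ultimately show ?thesis using full_cong by blast
  qed
  \<comment> \<open>The parent has rotated colour one larger, and on a narrow walk that is still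
    below \<open>K\<close>.\<close>
  have low: "Suc (rot (ty p) (g p)) < K" if p: "p \<in> P" for p
  proof -
    obtain x where x: "x \<in> V" "ty x = ty p" "Suc (rot (ty p) (g p)) = rot (ty p) (g x)" "ty p < 2"
      using G_parent p by blast
    then have "narrow (ty p) (\<lambda>i. g (W x i))" using W_walk[OF x(1)] by (simp add: walk_def)
    then show ?thesis using narrow_less[of "ty p" "\<lambda>i. g (W x i)"] x W0[OF x(1)] by simp
  qed
  have leaf_full: "\<exists>R. full h R \<and> (\<forall>i<K. W q i \<in> R ` {..K})" if q: "leaf q" for q
  proof -
    have qP: "q \<in> P" "q \<in> V" using q PV by (auto simp: leaf_def)
    obtain x where x: "x \<in> V" "x \<noteq> q" "E q x" "W q = case_nat q (W x)" "ty x = ty q" and t: "ty q < 2"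
      using G_parent qP(1) by blast
    have "x \<in> range (W q)" unfolding x(4) by (rule range_eqI[of _ _ 1]) (simp add: W0[OF x(1)])
    then have "\<not> leaf x" using x(2) qP(2) by (auto simp: leaf_def)
    then have Wx: "g (W x i) = h (W x i)" for i using keep inner[OF x(1)] by simp
    have walk_x: "walk h (ty q) (W x)" using walk_cong[of g "W x" h, OF Wx] W_walk[OF x(1)] x(5) by simp
    show ?thesis
    proof (cases "rot (ty q) (h q) = K")
      case True
      then have "full h (W q)" unfolding x(4) using full_narrow[OF walk_x t] x(3) W0[OF x(1)] by simp
      moreover have "W q i \<in> W q ` {..K}" if "i < K" for i using that by (intro imageI) simp
      ultimately show ?thesis by blast
    next
      case False
      have "h q = g q \<and> (\<exists>v. E q v \<and> rot (ty q) (h v) = K)"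
      proof (cases "ty q = 0")
        case True
        then have qL: "q \<in> L 0" "q \<notin> L 1" using q by (simp_all add: L_def)
        moreover have "q \<notin> Q0" using False 2(3) True by (auto simp: rot_def)
        ultimately show ?thesis using 1(1,4) 2(4,5) True by (force simp: rot_def)
      next
        case False': False
        then have t1: "ty q = 1" using t by simp
        then have qL: "q \<in> L 1" "q \<notin> L 0" using q by (simp_all add: L_def)
        then have "q \<notin> Q0" using 2(1) by blast
        moreover have "q \<notin> Q1" using False 1(3)[of q] 2(4)[of q] \<open>q \<notin> Q0\<close> t1 K2 by (auto simp: rot_def)
        moreover obtain v where v: "E q v" "g1 v = K - 1" using 1(5) qL \<open>q \<notin> Q1\<close> by blast
        \<comment> \<open>The second round does not spoil the colour \<open>K - 1\<close> seen by
          \<open>q\<close>: a leaf of type \<open>0\<close> is untouched by the first round and has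
          colour below \<open>K - 1\<close> by \<open>low\<close>.\<close>
        moreover have "v \<notin> Q0"
        proof
          assume "v \<in> Q0"
          then have vL: "leaf v" "ty v = 0" using 2(1) by (auto simp: L_def)
          then have "v \<notin> L 1" by (simp add: L_def)
          then have "v \<notin> Q1" using 1(1) by blast
          then have "g v = K - 1" using v 1(4) by simp
          moreover have "v \<in> P" using vL by (simp add: leaf_def)
          ultimately show False using low[of v] vL K2 by (simp add: rot_def)
        qed
        ultimately show ?thesis using 1(4)[of q] 2(4)[of q] 2(4)[of v] t1 K2
          by (intro conjI exI[of _ v]) (simp_all add: rot_def)
      qed
      then obtain v where v: "E q v" "rot (ty q) (h v) = K" and hq: "h q = g q" by blast
      have "g (W q i) = h (W q i)" for i unfolding x(4) using Wx hq by (cases i) simp_all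
      then have "walk h (ty q) (W q)" using W_walk[OF qP(2)] by (rule walk_cong)
      then have "full h (case_nat v (W q))" using full_narrow[OF _ t] E_sym[OF v(1)] v W0[OF qP(2)] by simp
      moreover have "W q i \<in> case_nat v (W q) ` {..K}" if "i < K" for i
        by (rule image_eqI[of _ _ "Suc i"]) (use that in simp_all)
      ultimately show ?thesis by blast
    qed
  qed
  have "\<exists>R. full h R \<and> v \<in> R ` {..K}" if v: "v \<in> V" for v
  proof -
    consider "v \<in> X0" | "v \<in> P" | "v \<in> V - X0 - P" using v by blast
    then show ?thesis
    proof cases
      case 1
      then obtain R where R: "full g0 R" "range R \<subseteq> X0" "v \<in> R ` {..K}" using core_full by blast
      have "g0 (R i) = h (R i)" for i
      proof -
        have "R i \<in> X0" using R(2) by blast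
        then have "\<not> leaf (R i)" using PV by (auto simp: leaf_def)
        then show ?thesis using keep g0 \<open>R i \<in> X0\<close> by simp
      qed
      then show ?thesis using R full_cong by blast
    next
      case 3
      then have "full h (W v)" using wide_full G_wide v by blast
      moreover have "v \<in> W v ` {..K}" by (rule image_eqI[of _ _ 0]) (simp_all add: W0[OF v])
      ultimately show ?thesis by blast
    next
      case vP: 2
      define t where "t = ty v"
      \<comment> \<open>The bound on the rotated colours keeps \<open>v\<close> from being the last relevant entry of the walk of \<open>p\<close>.\<close>
      define anc where "anc p \<longleftrightarrow> p \<in> P \<and> ty p = t \<and> (\<exists>i<K. v = W p i) \<and> rot t (g p) \<le> rot t (g v)" for p
      have "anc v" unfolding anc_def t_def using vP W0[OF v] K2 by (auto intro!: exI[of _ 0])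
      \<comment> \<open>With least rotated colour, \<open>p\<close> is a leaf or has a child with a
        wide walk, since a pending child would again satisfy \<open>anc\<close> with a smaller
        value.\<close>
      then obtain p where p: "anc p" and min: "\<And>r. anc r \<Longrightarrow> rot t (g p) \<le> rot t (g r)"
        using ex_has_least_nat[of anc v "\<lambda>p. rot t (g p)"] by blast
      obtain i where i: "i < K" "v = W p i" using p by (auto simp: anc_def)
      have pP: "p \<in> P" "ty p = t" "p \<in> V" using p PV by (auto simp: anc_def)
      show ?thesis
      proof (cases "leaf p")
        case True
        then show ?thesis using leaf_full i by blast
      next
        case False
        then obtain x where "x \<in> V" "x \<noteq> p" "p \<in> range (W x)" using pP(1) by (auto simp: leaf_def)
        then obtain r where r: "r \<in> V" "W r = case_nat r (W p)"
          "ty r = 2 \<or> r \<in> P \<and> ty r = ty p \<and> Suc (rot (ty p) (g r)) = rot (ty p) (g p)"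
          using G_child pP(1) by blast
        have vr: "v = W r (Suc i)" using r(2) i by simp
        show ?thesis
        proof (cases "ty r = 2")
          case True
          then have "full h (W r)" using wide_full r(1) by blast
          moreover have "v \<in> W r ` {..K}" by (rule image_eqI[of _ _ "Suc i"]) (use vr i in simp_all)
          ultimately show ?thesis by blast
        next
          case False
          then have r': "r \<in> P" "ty r = t" "Suc (rot t (g r)) = rot t (g p)" using r(3) pP by auto
          \<comment> \<open>As entry \<open>K - 1\<close> of \<open>W p\<close>, the vertex
            \<open>v\<close> would have the rotated colour of \<open>p\<close> minus one, against
            the bound in \<open>anc\<close>.\<close>
          have "Suc i \<noteq> K"
          proof
            assume eq: "Suc i = K"
            have "walk g t (W p)" "t \<noteq> 2" using W_walk[OF pP(3)] pP G_parent by auto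
            then have "narrow t (\<lambda>i. g (W p i))" by (simp add: walk_def)
            from narrowD[OF this i(1)] have "rot t (g v) = (Suc (rot t (g r)) + i) mod K"
              using i(2) W0[OF pP(3)] r'(3) by simp
            also have "Suc (rot t (g r)) + i = rot t (g r) + K" using eq by simp
            also have "(rot t (g r) + K) mod K = rot t (g r)" using low[OF r'(1)] r'(2) by simp
            finally show False using p r'(3) by (simp add: anc_def)
          qed
          then have "anc r" using r' vr i p unfolding anc_def by (auto intro!: exI[of _ "Suc i"])
          then show ?thesis using min[of r] r'(3) by simp
        qed
      qed
    qed
  qed
  then show ?thesis using 2(2) by blast
qed


end

section \<open>Transfer to the original definitions\<close>

lemma connected_graph_cut:
  assumes "connected_graph V E" "S \<subseteq> V" "S \<noteq> {}" "S \<noteq> V"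
  shows "\<exists>s u. s \<in> S \<and> u \<in> V - S \<and> E s u"
proof (rule ccontr)
  assume no: "\<not> ?thesis"
  obtain a b where ab: "a \<in> S" "b \<in> V - S" using assms by blast
  then obtain P where P: "is_path V E P" "hd P = a" "last P = b"
    using assms(1,2) unfolding connected_graph_def by blast
  have P_V: "P ! i \<in> V" if "i < length P" for i using P(1) that nth_mem unfolding is_path_def by blast
  have "P ! i \<in> S" if "i < length P" for i
    using that
  proof (induction i)
    case 0
    then show ?case using P ab by (simp add: hd_conv_nth)
  next
    case (Suc i)
    then have "E (P ! i) (P ! Suc i)" using P(1) unfolding is_path_def by blast
    then show ?case using Suc no P_V[of "Suc i"] by auto
  qed
  then have "last P \<in> S" using P(1) by (simp add: is_path_def last_conv_nth)
  then show False using P(3) ab by blast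
qed

lemma full_rainbow_path_upt:
  assumes "\<And>i. Suc i < k \<Longrightarrow> E (P i) (P (Suc i))" "\<And>i. i < k \<Longrightarrow> P i \<in> V"
    "inj_on (\<lambda>i. f (P i)) {..<k}" "0 < k"
  shows "full_rainbow_path V E k f (map P [0..<k])"
proof -
  have "inj_on P {..<k}" using assms(3) unfolding inj_on_def by metis
  then have "distinct (map P [0..<k])" by (simp add: distinct_map atLeast0LessThan)
  then show ?thesis using assms
    unfolding full_rainbow_path_def rainbow_path_def is_path_def inj_on_def by auto
qed

theorem theorem1:
  fixes V :: "'a set" and E :: "'a \<Rightarrow> 'a \<Rightarrow> bool" and k :: nat
  assumes "simple_graph V E"
    and "connected_graph V E"
    and "chromatic_number V E = k"
  shows "\<exists>f. is_coloring V E k f \<and>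
           (\<forall>v\<in>V. \<exists>P. full_rainbow_path V E k f P \<and> v \<in> set P)"
proof -
  have fin: "finite V" and EV: "\<And>u v. E u v \<Longrightarrow> u \<in> V \<and> v \<in> V" and sym: "\<And>u v. E u v \<Longrightarrow> E v u"
    and irr: "\<And>v. \<not> E v v"
    using assms(1) unfolding simple_graph_def by blast+
  have "V \<noteq> {}" using assms(2) by (simp add: connected_graph_def)
  note cut = connected_graph_cut[OF assms(2)]
  \<comment> \<open>An injective numbering of \<open>V\<close> is a colouring, so the
    \<open>LEAST\<close> in \<open>chromatic_number\<close> is attained.\<close>
  have "\<exists>k f. is_coloring V E k f"
  proof -
    obtain e :: "'a \<Rightarrow> nat" and n where e: "e ` V = {i. i < n}" "inj_on e V"
      using finite_imp_inj_to_nat_seg[OF fin] by blast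
    have "e v < n" if "v \<in> V" for v using e(1) that by blast
    moreover have "e u \<noteq> e v" if "E u v" for u v using EV[OF that] e(2) irr that unfolding inj_on_def by metis
    ultimately have "is_coloring V E n (\<lambda>v. Suc (e v))" unfolding is_coloring_def by fastforce
    then show ?thesis by blast
  qed
  then have "\<exists>f. is_coloring V E k f" using LeastI_ex[of "\<lambda>k. \<exists>f. is_coloring V E k f"] assms(3)
    unfolding chromatic_number_def by simp
  then obtain f0 where f0: "is_coloring V E k f0" by blast
  have least: "\<not> is_coloring V E j f" if "j < k" for j f
    using that not_less_Least[of j "\<lambda>k. \<exists>f. is_coloring V E k f"] assms(3) unfolding chromatic_number_def by blast
  have "0 < k" using f0 \<open>V \<noteq> {}\<close> unfolding is_coloring_def by fastforce
  show ?thesis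
  proof (cases "k \<le> 2")
    case True
    \<comment> \<open>With at most two colours any colouring works: the path is \<open>v\<close>
      alone, or an edge at \<open>v\<close>, which exists since one colour does not suffice.\<close>
    have "\<exists>P. full_rainbow_path V E k f0 P \<and> v \<in> set P" if v: "v \<in> V" for v
    proof (cases "k = 1")
      case True
      then have "full_rainbow_path V E k f0 [v]"
        using v by (simp add: full_rainbow_path_def rainbow_path_def is_path_def)
      then show ?thesis by (intro exI[of _ "[v]"]) simp
    next
      case False
      then have k: "k = 2" using True \<open>0 < k\<close> by simp
      have "V \<noteq> {v}"
      proof
        assume "V = {v}"
        then have "is_coloring V E 1 (\<lambda>_. 1)" using EV irr unfolding is_coloring_def by auto
        then show False using least k by simp
      qed
      then obtain u where "E v u" using cut[of "{v}"] v by blast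
      moreover from this have "u \<in> V" "u \<noteq> v" "f0 u \<noteq> f0 v"
        using EV irr f0 sym unfolding is_coloring_def by blast+
      ultimately have "full_rainbow_path V E k f0 [v, u]"
        using v k
        by (auto simp: full_rainbow_path_def rainbow_path_def is_path_def is_coloring_def less_Suc_eq nth_Cons')
      then show ?thesis by (intro exI[of _ "[v, u]"]) simp
    qed
    then show ?thesis using f0 by blast
  next
    case False
    define K where "K = k - 1"
    have k: "k = Suc K" using False K_def by simp
    interpret chromatic_graph V E K
    proof
      show "2 \<le> K" using False K_def by simp
      show "\<not> (\<exists>f::'a \<Rightarrow> nat. (\<forall>v\<in>V. f v < K) \<and> (\<forall>u v. E u v \<longrightarrow> f u \<noteq> f v))"
      proof
        assume "\<exists>f::'a \<Rightarrow> nat. (\<forall>v\<in>V. f v < K) \<and> (\<forall>u v. E u v \<longrightarrow> f u \<noteq> f v)"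
        then obtain f :: "'a \<Rightarrow> nat" where "\<forall>v\<in>V. f v < K" "\<forall>u v. E u v \<longrightarrow> f u \<noteq> f v" by blast
        then have "is_coloring V E K (\<lambda>v. Suc (f v))" unfolding is_coloring_def by fastforce
        then show False using least k by blast
      qed
      have f0_range: "1 \<le> f0 v" "f0 v \<le> Suc K" if "v \<in> V" for v
        using f0 that k by (auto simp: is_coloring_def)
      have "f0 v - 1 \<le> K" if "v \<in> V" for v using f0_range[OF that] by simp
      moreover have "f0 u - 1 \<noteq> f0 v - 1" if "E u v" for u v
      proof -
        have "f0 u \<noteq> f0 v" using f0 that by (simp add: is_coloring_def)
        then show ?thesis using f0_range[of u] f0_range[of v] EV[OF that] by linarith
      qed
      ultimately show "\<exists>f::'a \<Rightarrow> nat. (\<forall>v\<in>V. f v \<le> K) \<and> (\<forall>u v. E u v \<longrightarrow> f u \<noteq> f v)"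
        by (intro exI[of _ "\<lambda>v. f0 v - 1"]) blast
    qed (use fin EV sym irr cut in blast)+
    obtain h where h: "proper h" "\<forall>v\<in>V. \<exists>P. full h P \<and> v \<in> P ` {..K}" using ex_full_colouring by blast
    have "is_coloring V E k (\<lambda>v. Suc (h v))" using h(1) k by (auto simp: is_coloring_def proper_def)
    moreover have "\<exists>Q. full_rainbow_path V E k (\<lambda>v. Suc (h v)) Q \<and> v \<in> set Q" if "v \<in> V" for v
    proof -
      obtain P where P: "full h P" "v \<in> P ` {..K}" using h(2) \<open>v \<in> V\<close> by blast
      have edge: "E (P i) (P (Suc i))" if "i < K" for i using P(1) that by (simp add: full_def)
      have "P i \<in> V" if "i < k" for i
        using edge[of i] edge[of "i - 1"] EV that k K2 by (cases i) (auto simp: less_Suc_eq)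
      moreover have "inj_on (\<lambda>i. Suc (h (P i))) {..<k}"
        using P(1) k by (auto simp: full_def inj_on_def lessThan_Suc_atMost)
      ultimately have "full_rainbow_path V E k (\<lambda>v. Suc (h v)) (map P [0..<k])"
        using edge k by (intro full_rainbow_path_upt) auto
      moreover have "v \<in> set (map P [0..<k])" using P(2) k by (simp add: atLeast0LessThan lessThan_Suc_atMost del: upt_Suc)
      ultimately show ?thesis by blast
    qed
    ultimately show ?thesis by blast
  qed
qed

end
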